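(* Let $p\geq 0$ and let $G$ be a balanced bipartite graph of order $2n$ with minimum degree $\delta(G)\geq k$, where $n\geq (k+2)(k-p+1)$. If $k\geq p+1$ and $q(G)\geq q(M_{n,n}^{n-k,k-p})$, then $G$ is $2p$-Hamilton-biconnected unless $G= M_{n,n}^{n-k,k-p}$.
   Context: $q(G)$ is the signless Laplacian spectral radius, i.e. the largest eigenvalue of $D(G)+A(G)$ where $D(G)$ is the diagonal degree matrix and $A(G)$ the adjacency matrix. A bipartite graph $G=(X,Y;E)$ is balanced if $|X|=|Y|$; it is Hamilton-biconnected if for every $u\in X$, $v\in Y$ there is a Hamiltonian path with ends $u,v$. A vertex set $W$ is balanced if $|W\cap X|=|W\cap Y|$; $G$ is $2p$-Hamilton-biconnected if for every balanced $W$ with $|W|=2p$, the subgraph induced by $V(G)\setminus W$ is Hamilton-biconnected. $M_{n,m}^{s,t}$: parts $X=X_1\cup X_2$, $Y=Y_1\cup Y_2$, $|X_1|=s$, $|X_2|=n-s$, $|Y_1|=m-t$, $|Y_2|=t$; edges are all pairs between $X_1$ and $Y_1$, between $X_2$ and $Y_1$, and between $X_2$ and $Y_2$. "$G=H$" means isomorphic. *)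

theory Defs
  imports Complex_Main
begin

definition bipartite_graph :: "'a set \<Rightarrow> 'a set \<Rightarrow> 'a set set \<Rightarrow> bool" where
  "bipartite_graph X Y E \<longleftrightarrow> finite X \<and> finite Y \<and> X \<inter> Y = {} \<and>
     E \<subseteq> {{x, y} | x y. x \<in> X \<and> y \<in> Y}"

definition adj :: "'a set set \<Rightarrow> 'a \<Rightarrow> 'a \<Rightarrow> bool" where
  "adj E x y \<longleftrightarrow> {x, y} \<in> E"

definition degree :: "'a set \<Rightarrow> 'a set set \<Rightarrow> 'a \<Rightarrow> nat" where
  "degree V E x = card {y \<in> V. adj E x y}"

definition signless_laplacian :: "'a set \<Rightarrow> 'a set set \<Rightarrow> 'a \<Rightarrow> 'a \<Rightarrow> real" where
  "signless_laplacian V E x y =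
     (if x = y then real (degree V E x) else 0) + (if adj E x y then 1 else 0)"

text \<open>Eigenvalues of Q (Q is real symmetric, so all eigenvalues are real).\<close>
definition Q_eigenvalues :: "'a set \<Rightarrow> 'a set set \<Rightarrow> real set" where
  "Q_eigenvalues V E = {mu. \<exists>v :: 'a \<Rightarrow> real. (\<exists>x\<in>V. v x \<noteq> 0) \<and>
      (\<forall>x\<in>V. (\<Sum>y\<in>V. signless_laplacian V E x y * v y) = mu * v x)}"

definition q_radius :: "'a set \<Rightarrow> 'a set set \<Rightarrow> real" where
  "q_radius V E = Max (Q_eigenvalues V E)"

definition ham_path :: "'a set set \<Rightarrow> 'a set \<Rightarrow> 'a \<Rightarrow> 'a \<Rightarrow> 'a list \<Rightarrow> bool" where
  "ham_path E S u v ps \<longleftrightarrow> ps \<noteq> [] \<and> distinct ps \<and> set ps = S \<and>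
     hd ps = u \<and> last ps = v \<and> (\<forall>i. Suc i < length ps \<longrightarrow> adj E (ps ! i) (ps ! Suc i))"

definition ham_biconnected :: "'a set \<Rightarrow> 'a set \<Rightarrow> 'a set set \<Rightarrow> bool" where
  "ham_biconnected X Y E \<longleftrightarrow>
     (\<forall>u\<in>X. \<forall>v\<in>Y. \<exists>ps. ham_path E (X \<union> Y) u v ps)"

definition ham_biconnected_2p :: "nat \<Rightarrow> 'a set \<Rightarrow> 'a set \<Rightarrow> 'a set set \<Rightarrow> bool" where
  "ham_biconnected_2p p X Y E \<longleftrightarrow>
     (\<forall>W. W \<subseteq> X \<union> Y \<longrightarrow> card (W \<inter> X) = card (W \<inter> Y) \<longrightarrow> card W = 2 * p \<longrightarrow>
        ham_biconnected (X - W) (Y - W) E)"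

definition graph_iso :: "'a set \<Rightarrow> 'a set set \<Rightarrow> 'b set \<Rightarrow> 'b set set \<Rightarrow> bool" where
  "graph_iso V E V' E' \<longleftrightarrow> (\<exists>f. bij_betw f V V' \<and>
     (\<forall>x\<in>V. \<forall>y\<in>V. adj E x y \<longleftrightarrow> adj E' (f x) (f y)))"

text \<open>The graph M_{n,m}^{s,t} on vertices (0,i), i<n (class X) and (1,j), j<m (class Y);
  X1 = {(0,i) | i<s}, X2 = {(0,i) | s\<le>i<n}, Y1 = {(1,j) | j<m-t}, Y2 = {(1,j) | m-t\<le>j<m}.
  Edges: X1-Y1, X2-Y1, X2-Y2 (all pairs).\<close>
definition M_X :: "nat \<Rightarrow> (nat \<times> nat) set" where
  "M_X n = {(0, i) | i. i < n}"

definition M_Y :: "nat \<Rightarrow> (nat \<times> nat) set" where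
  "M_Y m = {(1, j) | j. j < m}"

definition M_E :: "nat \<Rightarrow> nat \<Rightarrow> nat \<Rightarrow> nat \<Rightarrow> (nat \<times> nat) set set" where
  "M_E n m s t = {{(0, i), (1, j)} | i j. i < n \<and> j < m \<and>
      ((i < s \<and> j < m - t) \<or> (s \<le> i \<and> j < m - t) \<or> (s \<le> i \<and> m - t \<le> j))}"

end

theory Submission
  imports "HOL-Analysis.Function_Topology" Defs
begin

text \<open>Put t = k - p. The degrees are a Collatz--Wielandt weight giving q(G) \<le> n + e(G)/n, while a
  test vector gives q(M) > 2n - t, so fewer than nt edges are missing from G. If deleting W
  leaves no Hamiltonian path from u to v, complete G - W to an edge-maximal graph without such a path:
  there, with m = n - p, non-adjacent x and y have d(x) + d(y) \<le> m + 1, with equality only if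
  x is adjacent to v and y to u. Counting missing edges around a non-adjacent pair of maximal degree sum
  leaves two possibilities: t vertices on one side have degree at most k in G, or t = 2 and two
  adjacent vertices have degree at most k. In the first case, shifting the neighbourhoods of the t
  low vertices onto the k largest entries of a Perron vector shows q(G) \<le> q(M), with equality
  only for G = M. In the second case an explicit weight and a test vector separate q(G) < q(M).\<close>

section \<open>Closing a bipartite graph under alternating Hamiltonian paths\<close>

text \<open>With \<open>k = t + p\<close> and \<open>m = n - p\<close>, the bound on n says exactly
  \<open>n * t \<le> (t + 1) * (n - k - 2)\<close>: fewer than nt missing edges of G become fewer
  than (t+1)(m-t-2) after the deletion of W. As t vertices of degree t already miss t(m-t) pairs,
  only m-3t-2 remain for any other defect, and one further non-adjacent pair costs about m.

  Fixing u and v before closing the graph is what yields the equality clause; the adjacencies with v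
  and u that it provides allow the paths to be written down in the tight configurations, where
  counting alone does not decide.

  The t = 2 configuration resists path arguments: if y has neighbours u, x and x has neighbours y,
  v, all these edges are forced and the path u, y, x, v closes too early. Edge counting does not
  exclude it either, since it can have as many edges as M, namely n*n - 2(n-k). Both radii are 2n-2
  to first order, and only the next terms differ: about k/n for M against (k-1)/n for large
  n.\<close>

text \<open>A path from u to v in which X occupies the even and Y the odd positions; when both
  classes have m elements, it is Hamiltonian.\<close>

definition alt_path :: "'a set \<Rightarrow> 'a set \<Rightarrow> 'a set set \<Rightarrow> 'a \<Rightarrow> 'a \<Rightarrow> nat \<Rightarrow> (nat \<Rightarrow> 'a) \<Rightarrow> bool" where
  "alt_path X Y E u v m c \<longleftrightarrow> inj_on c {..<2 * m} \<and> (\<forall>i<2 * m. c i \<in> (if even i then X else Y)) \<and>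
     c 0 = u \<and> c (2 * m - 1) = v \<and> (\<forall>i. Suc i < 2 * m \<longrightarrow> adj E (c i) (c (Suc i)))"

definition nbs :: "'a set set \<Rightarrow> 'a set \<Rightarrow> 'a \<Rightarrow> 'a set" where
  "nbs E S v = {w \<in> S. adj E v w}"

lemma adj_sym: "adj E x y \<longleftrightarrow> adj E y x"
  by (simp add: adj_def insert_commute)

text \<open>Reversing the segment from p+1 to q replaces the edges after positions p and q by the
  two new ones. The reversal sends l to p+1+q-l, which preserves the side of each vertex because p+q
  is odd.\<close>

lemma alt_path_two_opt:
  assumes inj: "inj_on c {..<2 * m}"
    and side: "\<forall>l<2 * m. c l \<in> (if even l then X else Y)"
    and ends: "c 0 = u" "c (2 * m - 1) = v"
    and adj: "\<And>l. Suc l < 2 * m \<Longrightarrow> l \<noteq> p \<Longrightarrow> l \<noteq> q \<Longrightarrow> adj E (c l) (c (Suc l))"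
    and pq: "p < q" "Suc q < 2 * m" "odd (p + q)"
    and new: "adj E (c p) (c q)" "adj E (c (Suc p)) (c (Suc q))"
  shows "\<exists>c'. alt_path X Y E u v m c'"
proof -
  define r where "r l = (if p < l \<and> l \<le> q then p + 1 + q - l else l)" for l
  have r_less: "r l < 2 * m" if "l < 2 * m" for l
    using that pq by (auto simp: r_def)
  have r_inj: "inj_on r {..<2 * m}"
    by (auto simp: inj_on_def r_def split: if_splits)
  have "inj_on (c \<circ> r) {..<2 * m}"
    by (rule comp_inj_on[OF r_inj inj_on_subset[OF inj]]) (use r_less in auto)
  moreover have "(c \<circ> r) l \<in> (if even l then X else Y)" if "l < 2 * m" for l
  proof -
    have "even (r l) = even l"
      using pq by (auto simp: r_def)
    then show ?thesis
      using side r_less[OF that] by (metis comp_apply)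
  qed
  moreover have "(c \<circ> r) 0 = u" "(c \<circ> r) (2 * m - 1) = v"
    using ends pq by (auto simp: r_def)
  moreover have "adj E ((c \<circ> r) l) ((c \<circ> r) (Suc l))" if l: "Suc l < 2 * m" for l
  proof -
    consider "l < p" | "l = p" | "p < l" "l < q" | "l = q" | "q < l"
      by linarith
    then show ?thesis
    proof cases
      case 1
      then show ?thesis using adj[OF l] pq by (auto simp: r_def)
    next
      case 2
      then show ?thesis using new pq by (auto simp: r_def)
    next
      case 3
      have "adj E (c (p + q - l)) (c (Suc (p + q - l)))"
        by (rule adj) (use 3 pq in auto)
      moreover have "Suc (p + q - l) = p + 1 + q - l"
        using 3 by auto
      ultimately show ?thesis
        using 3 by (auto simp: r_def adj_sym)
    next
      case 4
      then show ?thesis using new pq by (auto simp: r_def)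
    next
      case 5
      then show ?thesis using adj[OF l] pq by (auto simp: r_def)
    qed
  qed
  ultimately show ?thesis
    unfolding alt_path_def by blast
qed

lemma card_less_parity:
  "card {j. j < 2 * m - 1 \<and> odd j} = m - 1" "card {j. j < 2 * m - 1 \<and> even j} = m"
proof -
  have "bij_betw (\<lambda>l. 2 * l + 1) {..<m - 1} {j. j < 2 * m - 1 \<and> odd j}"
    by (rule bij_betwI[where g = "\<lambda>j. j div 2"]) (auto elim!: oddE)
  from bij_betw_same_card[OF this] show "card {j. j < 2 * m - 1 \<and> odd j} = m - 1" by simp
  have "bij_betw (\<lambda>l. 2 * l) {..<m} {j. j < 2 * m - 1 \<and> even j}"
    by (rule bij_betwI[where g = "\<lambda>j. j div 2"]) (auto elim!: evenE)
  from bij_betw_same_card[OF this] show "card {j. j < 2 * m - 1 \<and> even j} = m" by simp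
qed

lemma alt_path_sides:
  assumes "finite X" "finite Y" "X \<inter> Y = {}" "card X = m" "card Y = m"
    and inj: "inj_on c {..<2 * m}" and side: "\<forall>l<2 * m. c l \<in> (if even l then X else Y)"
  shows "X = c ` {j. j < 2 * m \<and> even j}" "Y = c ` {j. j < 2 * m \<and> odd j}"
    "c ` {..<2 * m} = X \<union> Y"
proof -
  have sub: "c ` {..<2 * m} \<subseteq> X \<union> Y"
    using side by (auto split: if_splits)
  have "card (c ` {..<2 * m}) = card (X \<union> Y)"
    using assms by (simp add: card_image card_Un_disjoint)
  then show eq: "c ` {..<2 * m} = X \<union> Y"
    using sub assms(1,2) by (intro card_subset_eq) auto
  show "X = c ` {j. j < 2 * m \<and> even j}"
  proof safe
    fix x assume "x \<in> X"
    then obtain j where "j < 2 * m" "x = c j" using eq by blast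
    moreover from this have "even j"
      using side \<open>x \<in> X\<close> assms(3) by (metis disjoint_iff)
    ultimately show "x \<in> c ` {j. j < 2 * m \<and> even j}" by auto
  qed (use side in auto)
  show "Y = c ` {j. j < 2 * m \<and> odd j}"
  proof safe
    fix x assume "x \<in> Y"
    then obtain j where "j < 2 * m" "x = c j" using eq by blast
    moreover from this have "odd j"
      using side \<open>x \<in> Y\<close> assms(3) by (metis disjoint_iff)
    ultimately show "x \<in> c ` {j. j < 2 * m \<and> odd j}" by auto
  qed (use side in auto)
qed

text \<open>A crossing argument of Ore type. The new path uses xy exactly once, between positions i
  and i+1. An index j with c i adjacent to c j and c (i+1) to c (j+1) would let
  \<open>alt_path_two_opt\<close> avoid xy, so \<open>A\<close> and \<open>B\<close> are disjoint
  sets of indices below 2m-1 of parity opposite to i. If i is even there are m-1 such indices, and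
  only v (without successor) and u (without predecessor) escape the count, whence m+1 and the
  equality clause. If i is odd there are m of them and no neighbour escapes, so the sum is at most
  m.\<close>

lemma alt_path_closure:
  assumes fin: "finite X" "finite Y" and disj: "X \<inter> Y = {}" and card: "card X = m" "card Y = m"
    and xy: "x \<in> X" "y \<in> Y"
    and no: "\<nexists>c. alt_path X Y E u v m c"
    and ex: "\<exists>c. alt_path X Y (insert {x, y} E) u v m c"
  shows "card (nbs E Y x) + card (nbs E X y) \<le> m + 1"
    and "card (nbs E Y x) + card (nbs E X y) = m + 1 \<Longrightarrow> adj E x v \<and> adj E u y"
proof -
  obtain c where c: "alt_path X Y (insert {x, y} E) u v m c" using ex by blast
  have inj: "inj_on c {..<2 * m}" and side: "\<forall>l<2 * m. c l \<in> (if even l then X else Y)"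
    and ends: "c 0 = u" "c (2 * m - 1) = v"
    and adj': "\<And>l. Suc l < 2 * m \<Longrightarrow> adj (insert {x, y} E) (c l) (c (Suc l))"
    using c unfolding alt_path_def by auto
  obtain i where i: "Suc i < 2 * m" "\<not> adj E (c i) (c (Suc i))"
    using c no unfolding alt_path_def by blast
  have ixy: "{c i, c (Suc i)} = {x, y}"
    using adj'[OF i(1)] i(2) by (auto simp: adj_def)
  have adj: "adj E (c l) (c (Suc l))" if l: "Suc l < 2 * m" "l \<noteq> i" for l
  proof (rule ccontr)
    assume "\<not> adj E (c l) (c (Suc l))"
    then have eq: "{c l, c (Suc l)} = {c i, c (Suc i)}"
      using adj'[OF l(1)] ixy by (auto simp: adj_def)
    have "c l = c i \<and> c (Suc l) = c (Suc i) \<or> c l = c (Suc i) \<and> c (Suc l) = c i"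
      using eq by (auto simp: doubleton_eq_iff)
    then show False
      using inj_onD[OF inj, of l i] inj_onD[OF inj, of l "Suc i"] inj_onD[OF inj, of "Suc l" i] i l
      by auto
  qed
  define A where "A = {j. j < 2 * m - 1 \<and> odd (i + j) \<and> adj E (c i) (c j)}"
  define B where "B = {j. j < 2 * m - 1 \<and> odd (i + j) \<and> adj E (c (Suc i)) (c (Suc j))}"
  have fAB: "finite A" "finite B" unfolding A_def B_def by auto
  have AB: "A \<inter> B = {}"
  proof (rule ccontr)
    assume "A \<inter> B \<noteq> {}"
    then obtain j where j: "j < 2 * m - 1" "odd (i + j)" "adj E (c i) (c j)"
      "adj E (c (Suc i)) (c (Suc j))" unfolding A_def B_def by blast
    have "j \<noteq> i" using j(2) by auto
    have "\<exists>c'. alt_path X Y E u v m c'"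
    proof (cases "i < j")
      case True
      show ?thesis
        by (rule alt_path_two_opt[OF inj side ends, of i j])
           (use adj True j i in \<open>auto simp: add.commute\<close>)
    next
      case False
      show ?thesis
        by (rule alt_path_two_opt[OF inj side ends, of j i])
           (use adj False j i \<open>j \<noteq> i\<close> in \<open>auto simp: add.commute adj_sym\<close>)
    qed
    with no show False by blast
  qed
  have cAB: "card A + card B \<le> card {j. j < 2 * m - 1 \<and> odd (i + j)}"
  proof -
    have "card A + card B = card (A \<union> B)"
      using fAB AB by (simp add: card_Un_disjoint)
    also have "\<dots> \<le> card {j. j < 2 * m - 1 \<and> odd (i + j)}"
      by (rule card_mono) (auto simp: A_def B_def)
    finally show ?thesis .
  qed
  note sides = alt_path_sides[OF fin disj card inj side]
  have m: "m > 0" using i by auto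
  have fnb: "finite (nbs E Y x)" "finite (nbs E X y)"
    using fin by (auto simp: nbs_def)
  have "card (nbs E Y x) + card (nbs E X y) \<le> m + 1 \<and>
     (card (nbs E Y x) + card (nbs E X y) = m + 1 \<longrightarrow> adj E x v \<and> adj E u y)"
  proof (cases "even i")
    case True
    have "c i \<in> X" "c (Suc i) \<in> Y"
      using side i True by (auto dest: spec[of _ i] spec[of _ "Suc i"])
    then have eq: "c i = x" "c (Suc i) = y"
      using ixy xy disj by (auto simp: doubleton_eq_iff)
    have "nbs E Y x - {v} \<subseteq> c ` A"
    proof
      fix w assume w: "w \<in> nbs E Y x - {v}"
      then have "w \<in> Y" "adj E x w" "w \<noteq> v" by (auto simp: nbs_def)
      then obtain j where j: "j < 2 * m" "odd j" "w = c j"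
        using sides(2) by blast
      with \<open>w \<noteq> v\<close> ends have "j \<noteq> 2 * m - 1" by auto
      then have "j \<in> A" using j \<open>adj E x w\<close> eq True by (auto simp: A_def)
      then show "w \<in> c ` A" using j by auto
    qed
    then have 1: "card (nbs E Y x - {v}) \<le> card A"
      using fAB surj_card_le by blast
    have "nbs E X y - {u} \<subseteq> (c \<circ> Suc) ` B"
    proof
      fix w assume w: "w \<in> nbs E X y - {u}"
      then have "w \<in> X" "adj E y w" "w \<noteq> u" by (auto simp: nbs_def)
      then obtain j where j: "j < 2 * m" "even j" "w = c j"
        using sides(1) by blast
      with \<open>w \<noteq> u\<close> ends obtain j' where j': "j = Suc j'" by (cases j) auto
      then have "j' \<in> B" using j \<open>adj E y w\<close> eq True by (auto simp: B_def)
      then show "w \<in> (c \<circ> Suc) ` B" using j j' by auto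
    qed
    then have 2: "card (nbs E X y - {u}) \<le> card B"
      using fAB surj_card_le by blast
    have "{j. j < 2 * m - 1 \<and> odd (i + j)} = {j. j < 2 * m - 1 \<and> odd j}"
      using True by auto
    then have "card A + card B \<le> m - 1"
      using cAB card_less_parity(1)[of m] by simp
    moreover have "card (nbs E Y x) \<le> card (nbs E Y x - {v}) + (if adj E x v then 1 else 0)"
      using fnb by (cases "v \<in> nbs E Y x") (auto simp: card_Diff_singleton_if nbs_def)
    moreover have "card (nbs E X y) \<le> card (nbs E X y - {u}) + (if adj E u y then 1 else 0)"
      using fnb by (cases "u \<in> nbs E X y") (auto simp: card_Diff_singleton_if nbs_def adj_sym)
    ultimately show ?thesis using 1 2 m by (auto split: if_splits)
  next
    case False
    have "c i \<in> Y" "c (Suc i) \<in> X"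
      using side i False by (auto dest: spec[of _ i] spec[of _ "Suc i"])
    then have eq: "c i = y" "c (Suc i) = x"
      using ixy xy disj by (auto simp: doubleton_eq_iff)
    have "nbs E X y \<subseteq> c ` A"
    proof
      fix w assume w: "w \<in> nbs E X y"
      then have "w \<in> X" "adj E y w" by (auto simp: nbs_def)
      then obtain j where j: "j < 2 * m" "even j" "w = c j"
        using sides(1) by blast
      then have "j \<noteq> 2 * m - 1" using m by presburger
      then have "j \<in> A" using j \<open>adj E y w\<close> eq False by (auto simp: A_def)
      then show "w \<in> c ` A" using j by auto
    qed
    then have 1: "card (nbs E X y) \<le> card A"
      using fAB surj_card_le by blast
    have "nbs E Y x \<subseteq> (c \<circ> Suc) ` B"
    proof
      fix w assume w: "w \<in> nbs E Y x"
      then have "w \<in> Y" "adj E x w" by (auto simp: nbs_def)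
      then obtain j where j: "j < 2 * m" "odd j" "w = c j"
        using sides(2) by blast
      then obtain j' where j': "j = Suc j'" by (cases j) auto
      then have "j' \<in> B" using j \<open>adj E x w\<close> eq False by (auto simp: B_def)
      then show "w \<in> (c \<circ> Suc) ` B" using j j' by auto
    qed
    then have 2: "card (nbs E Y x) \<le> card B"
      using fAB surj_card_le by blast
    have "{j. j < 2 * m - 1 \<and> odd (i + j)} = {j. j < 2 * m - 1 \<and> even j}"
      using False by auto
    then have "card A + card B \<le> m"
      using cAB card_less_parity(2)[of m] by simp
    then show ?thesis using 1 2 by auto
  qed
  then show "card (nbs E Y x) + card (nbs E X y) \<le> m + 1"
    and "card (nbs E Y x) + card (nbs E X y) = m + 1 \<Longrightarrow> adj E x v \<and> adj E u y" by auto
qed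

lemma alt_path_reverse:
  assumes "alt_path X Y E u v m c" "m > 0"
  shows "alt_path Y X E v u m (\<lambda>i. c (2 * m - 1 - i))"
  unfolding alt_path_def
proof (intro conjI allI impI)
  note c = assms(1)[unfolded alt_path_def]
  show "inj_on (\<lambda>i. c (2 * m - 1 - i)) {..<2 * m}"
    using c unfolding inj_on_def
    by (metis (no_types, lifting) Suc_diff_1 assms(2) diff_diff_cancel diff_less_Suc lessThan_iff less_Suc_eq_le nat_0_less_mult_iff zero_less_numeral)
  show "c (2 * m - 1 - i) \<in> (if even i then Y else X)" if "i < 2 * m" for i
  proof -
    have "even (2 * m - 1 - i) \<longleftrightarrow> odd i" using that by auto
    then show ?thesis using c that
      by (metis diff_less_Suc Suc_diff_1 assms(2) nat_0_less_mult_iff zero_less_numeral)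
  qed
  show "c (2 * m - 1 - 0) = v" "c (2 * m - 1 - (2 * m - 1)) = u" using c by auto
  show "adj E (c (2 * m - 1 - i)) (c (2 * m - 1 - Suc i))" if "Suc i < 2 * m" for i
  proof -
    have "adj E (c (2 * m - 1 - Suc i)) (c (Suc (2 * m - 1 - Suc i)))"
      using c that by auto
    moreover have "Suc (2 * m - 1 - Suc i) = 2 * m - 1 - i" using that by auto
    ultimately show ?thesis by (simp add: adj_sym)
  qed
qed

lemma alt_path_of_lists:
  assumes disj: "X \<inter> Y = {}"
    and as: "distinct as" "set as = X" "length as = m"
    and bs: "distinct bs" "set bs = Y" "length bs = m"
    and m: "m > 0" and ends: "as ! 0 = u" "bs ! (m - 1) = v"
    and adj: "\<And>i. i < m \<Longrightarrow> adj E (as ! i) (bs ! i)"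
      "\<And>i. Suc i < m \<Longrightarrow> adj E (bs ! i) (as ! Suc i)"
  shows "\<exists>c. alt_path X Y E u v m c"
proof
  let ?c = "\<lambda>i. if even i then as ! (i div 2) else bs ! (i div 2)"
  show "alt_path X Y E u v m ?c"
    unfolding alt_path_def
  proof (intro conjI allI impI)
    have in_sides: "as ! i \<in> X" "bs ! i \<in> Y" if "i < m" for i
      using as bs that by auto
    show "inj_on ?c {..<2 * m}"
    proof (rule inj_onI)
      fix i j assume ij: "i \<in> {..<2 * m}" "j \<in> {..<2 * m}" "?c i = ?c j"
      then have d: "i div 2 < m" "j div 2 < m" by auto
      have par: "even i = even j"
        using in_sides[OF d(1)] in_sides[OF d(2)] ij(3) disj by (auto split: if_splits)
      have "i div 2 = j div 2"
        using ij(3) par d as bs nth_eq_iff_index_eq by (auto split: if_splits)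
      with par show "i = j"
        by (metis even_two_times_div_two odd_two_times_div_two_succ)
    qed
    show "?c i \<in> (if even i then X else Y)" if "i < 2 * m" for i
      using in_sides[of "i div 2"] that by auto
    show "?c 0 = u" using ends by simp
    have "(2 * m - 1) div 2 = m - 1" by simp
    then show "?c (2 * m - 1) = v" using ends m by simp
    show "adj E (?c i) (?c (Suc i))" if "Suc i < 2 * m" for i
    proof (cases "even i")
      case True
      then show ?thesis using adj(1)[of "i div 2"] that by auto
    next
      case False
      then have "Suc (i div 2) < m" using that by (auto elim!: oddE)
      then show ?thesis using adj(2)[of "i div 2"] False by auto
    qed
  qed
qed

lemma ham_path_of_alt_path:
  assumes "finite X" "finite Y" "X \<inter> Y = {}" "card X = m" "card Y = m" "m > 0"
    and c: "alt_path X Y E u v m c"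
  shows "ham_path E (X \<union> Y) u v (map c [0..<2 * m])"
proof -
  have inj: "inj_on c {..<2 * m}" and side: "\<forall>l<2 * m. c l \<in> (if even l then X else Y)"
    using c unfolding alt_path_def by auto
  show ?thesis
    using alt_path_sides(3)[OF assms(1-5) inj side] c assms(6)
    by (auto simp: ham_path_def alt_path_def distinct_map hd_map last_map atLeast0LessThan)
qed

lemma nbs_adjD:
  assumes "w \<in> nbs E S y"
  shows "adj E w y" "adj E y w" "w \<in> S"
  using assms adj_sym[of E w y] by (auto simp: nbs_def)

section \<open>Closed graphs without a path from u to v: locating the low vertices\<close>

text \<open>Edge-maximality enters only through \<open>closed\<close> and \<open>closed_eq\<close>,
  the two conclusions of \<open>alt_path_closure\<close>. The parameter t is the minimum degree left
  after at most p neighbours have been deleted, and \<open>miss\<close> is the budget for all later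
  counting.\<close>

locale closed_bigraph =
  fixes X Y :: "'a set" and E :: "'a set set" and u v :: 'a and m t :: nat
  assumes fin: "finite X" "finite Y" and disj: "X \<inter> Y = {}"
    and cardXY: "card X = m" "card Y = m"
    and uX: "u \<in> X" and vY: "v \<in> Y"
    and minX: "\<And>x. x \<in> X \<Longrightarrow> t \<le> card (nbs E Y x)"
    and minY: "\<And>y. y \<in> Y \<Longrightarrow> t \<le> card (nbs E X y)"
    and t1: "1 \<le> t"
    and miss: "card {(x, y). x \<in> X \<and> y \<in> Y \<and> \<not> adj E x y} < (t + 1) * (m - t - 2)"
    and no_path: "\<nexists>c. alt_path X Y E u v m c"
    and closed: "\<And>x y. x \<in> X \<Longrightarrow> y \<in> Y \<Longrightarrow> \<not> adj E x y \<Longrightarrow>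
      card (nbs E Y x) + card (nbs E X y) \<le> m + 1"
    and closed_eq: "\<And>x y. x \<in> X \<Longrightarrow> y \<in> Y \<Longrightarrow> \<not> adj E x y \<Longrightarrow>
      card (nbs E Y x) + card (nbs E X y) = m + 1 \<Longrightarrow> adj E x v \<and> adj E u y"
begin

abbreviation dX where "dX x \<equiv> card (nbs E Y x)"
abbreviation dY where "dY y \<equiv> card (nbs E X y)"
abbreviation non_edges where "non_edges \<equiv> {(x, y). x \<in> X \<and> y \<in> Y \<and> \<not> adj E x y}"

text \<open>Reading paths backwards exchanges (X, u) with (Y, v), and all assumptions are symmetric
  under this exchange. It later permits choosing y as the end of smaller degree.\<close>

lemma swap: "closed_bigraph Y X E v u m t"
proof
  have "bij_betw prod.swap non_edges {(x, y). x \<in> Y \<and> y \<in> X \<and> \<not> adj E x y}"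
    by (rule bij_betwI[where g = prod.swap]) (auto simp: adj_sym)
  then show "card {(x, y). x \<in> Y \<and> y \<in> X \<and> \<not> adj E x y} < (t + 1) * (m - t - 2)"
    using miss by (simp add: bij_betw_same_card)
  show "\<nexists>c. alt_path Y X E v u m c"
  proof
    assume "\<exists>c. alt_path Y X E v u m c"
    then obtain c where c: "alt_path Y X E v u m c" ..
    have "m > 0" using cardXY uX fin by (metis card_gt_0_iff empty_iff)
    from exI[of "alt_path X Y E u v m", OF alt_path_reverse[OF c this]]
    have "\<exists>c. alt_path X Y E u v m c" .
    then show False using no_path by (rule notE[rotated])
  qed
  fix x y assume xy: "x \<in> Y" "y \<in> X" "\<not> adj E x y"
  then have yx: "\<not> adj E y x" by (simp add: adj_sym)
  show "card (nbs E X x) + card (nbs E Y y) \<le> m + 1"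
    using closed[OF xy(2,1) yx] by (simp add: add.commute)
  show "adj E x u \<and> adj E v y" if "card (nbs E X x) + card (nbs E Y y) = m + 1"
    using closed_eq[OF xy(2,1) yx] that by (simp add: add.commute adj_sym)
qed (use fin disj cardXY uX vY minX minY t1 in auto)

lemma m_gt: "m > t + 2"
  using miss by (cases "m - t - 2") auto

lemma fin_nbs [simp]: "finite (nbs E X y)" "finite (nbs E Y x)"
  using fin by (auto simp: nbs_def)

lemma nbs_sub: "nbs E X y \<subseteq> X" "nbs E Y x \<subseteq> Y"
  by (auto simp: nbs_def)

lemma d_le: "dX x \<le> m" "dY y \<le> m"
  using card_mono[OF fin(2) nbs_sub(2)] card_mono[OF fin(1) nbs_sub(1)] cardXY by auto

lemma card_non_nbs: "card (Y - nbs E Y x) = m - dX x" "card (X - nbs E X y) = m - dY y"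
  using nbs_sub cardXY by (auto simp: card_Diff_subset)

lemma fin_non_edges: "finite non_edges"
  by (rule finite_subset[of _ "X \<times> Y"]) (use fin in auto)

lemma non_edges_column:
  assumes "B \<subseteq> Y" "\<forall>y\<in>B. dY y \<le> s"
  shows "card B * (m - s) \<le> card (non_edges \<inter> X \<times> B)"
proof -
  have fB: "finite B" using assms fin finite_subset by blast
  have eq: "non_edges \<inter> X \<times> B = prod.swap ` (SIGMA y:B. X - nbs E X y)"
    using assms(1) by (auto simp: nbs_def adj_sym image_iff)
  have "card (non_edges \<inter> X \<times> B) = card (SIGMA y:B. X - nbs E X y)"
    unfolding eq by (rule card_image) (auto simp: inj_on_def)
  also have "\<dots> = (\<Sum>y\<in>B. m - dY y)"
    using fB fin by (subst card_SigmaI) (auto simp: card_non_nbs)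
  finally have "card (non_edges \<inter> X \<times> B) = (\<Sum>y\<in>B. m - dY y)" .
  moreover have "card B * (m - s) \<le> (\<Sum>y\<in>B. m - dY y)"
    using assms(2) sum_mono[of B "\<lambda>_. m - s" "\<lambda>y. m - dY y"] by (simp add: diff_le_mono2)
  ultimately show ?thesis by simp
qed

lemma non_edges_bound:
  assumes B: "B \<subseteq> Y" "\<forall>y\<in>B. dY y \<le> s" and C: "C \<subseteq> non_edges" "C \<inter> X \<times> B = {}"
  shows "card B * (m - s) + card C \<le> card non_edges"
proof -
  have "card (non_edges \<inter> X \<times> B) + card C = card (non_edges \<inter> X \<times> B \<union> C)"
    using C fin_non_edges by (intro card_Un_disjoint[symmetric]) (auto intro: finite_subset)
  also have "\<dots> \<le> card non_edges"
    using C fin_non_edges by (intro card_mono) auto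
  finally show ?thesis using non_edges_column[OF B] by linarith
qed

text \<open>A missing edge of a closed graph forces about m further missing edges at its two ends.\<close>

lemma cross_bound:
  assumes B: "B \<subseteq> Y" "\<forall>y\<in>B. dY y \<le> s"
    and xy: "x0 \<in> X" "y0 \<in> Y - B" "\<not> adj E x0 y0"
  shows "card B * (m - s) + m \<le> card non_edges + card B + 2"
proof -
  define R where "R = Y - B - nbs E Y x0"
  define K where "K = X - nbs E X y0"
  have fB: "finite B" using B fin finite_subset by blast
  have fR: "finite R" "finite K" using fin by (auto simp: R_def K_def)
  have "Y \<subseteq> nbs E Y x0 \<union> B \<union> R" by (auto simp: R_def)
  then have "m \<le> card (nbs E Y x0 \<union> B \<union> R)"
    using cardXY fB fR by (metis card_mono fin_nbs(2) finite_Un)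
  also have "\<dots> \<le> dX x0 + card B + card R"
    by (meson card_Un_le le_trans add_le_mono1)
  finally have 1: "m \<le> dX x0 + card B + card R" .
  have 2: "dX x0 + dY y0 \<le> m + 1" using closed xy by auto
  have K: "card K = m - dY y0" by (simp add: K_def card_non_nbs)
  \<comment> \<open>The missing edges at \<open>x0\<close> outside B and those at \<open>y0\<close>
    share only the pair \<open>(x0, y0)\<close>. Hence there are at least (m - dX x0 - card B) + (m
    - dY y0) - 1 of them, which by \<open>closed\<close> is at least m - card B - 2.\<close>
  let ?C = "{x0} \<times> R \<union> K \<times> {y0}"
  have "{x0} \<times> R \<inter> K \<times> {y0} = {(x0, y0)}"
    using xy by (auto simp: R_def K_def nbs_def adj_sym)
  then have "card ?C + 1 = card R + card K"
    using card_Un_Int[of "{x0} \<times> R" "K \<times> {y0}"] fR by (simp add: card_cartesian_product)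
  moreover have "card B * (m - s) + card ?C \<le> card non_edges"
    by (rule non_edges_bound[OF B]) (use xy in \<open>auto simp: R_def K_def nbs_def adj_sym\<close>)
  ultimately show ?thesis using 1 2 K d_le(2)[of y0] by linarith
qed

text \<open>Once a path from u has absorbed all exceptional vertices \<open>bs\<close> of Y and
  returned to X, only complete adjacency remains, so the other vertices may follow in any order,
  with v saved for the end.\<close>

lemma alt_path_prefix:
  assumes as: "distinct as" "set as \<subseteq> X" "as \<noteq> []" "as ! 0 = u"
    and bs: "distinct bs" "set bs \<subseteq> Y - {v}" and len: "length as = length bs + 1"
    and adj: "\<And>i. i < length bs \<Longrightarrow> adj E (as ! i) (bs ! i)"
      "\<And>i. i < length bs \<Longrightarrow> adj E (bs ! i) (as ! Suc i)"
    and complete: "\<And>x y. x \<in> X \<Longrightarrow> y \<in> Y - set bs \<Longrightarrow> adj E x y"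
  shows False
proof -
  obtain rs where rs: "set rs = X - set as" "distinct rs"
    using finite_distinct_list[of "X - set as"] fin by auto
  obtain qs where qs: "set qs = Y - set bs - {v}" "distinct qs"
    using finite_distinct_list[of "Y - set bs - {v}"] fin by auto
  have d1: "distinct (as @ rs)" "set (as @ rs) = X"
    using as rs by auto
  have d2: "distinct (bs @ qs @ [v])" "set (bs @ qs @ [v]) = Y"
    using bs qs vY by auto
  have l1: "length (as @ rs) = m" using d1 cardXY by (metis distinct_card)
  have l2: "length (bs @ qs @ [v]) = m" using d2 cardXY by (metis distinct_card)
  have inX: "(as @ rs) ! i \<in> X" if "i < m" for i
    using d1 l1 that by (metis nth_mem)
  have inY: "(bs @ qs @ [v]) ! i \<in> Y - set bs" if "i < m" "i \<ge> length bs" for i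
  proof -
    have "(bs @ qs @ [v]) ! i = (qs @ [v]) ! (i - length bs)"
      using that by (simp add: nth_append)
    moreover have "i - length bs < length (qs @ [v])" using that l2 by auto
    ultimately have "(bs @ qs @ [v]) ! i \<in> set (qs @ [v])" by (metis nth_mem)
    then show ?thesis using qs bs vY by auto
  qed
  have "\<exists>c. alt_path X Y E u v m c"
  proof (rule alt_path_of_lists[OF disj d1 l1 d2 l2])
    show "m > 0" using l2 by auto
    show "(as @ rs) ! 0 = u" using as by (cases as) auto
    have "m - 1 = length (bs @ qs)" using l2 by auto
    then show "(bs @ qs @ [v]) ! (m - 1) = v" by (metis append.assoc nth_append_length)
    show "adj E ((as @ rs) ! i) ((bs @ qs @ [v]) ! i)" if "i < m" for i
    proof (cases "i < length bs")
      case True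
      then show ?thesis using adj(1)[OF True] len by (simp add: nth_append)
    next
      case False
      then show ?thesis using complete inX inY that by simp
    qed
    show "adj E ((bs @ qs @ [v]) ! i) ((as @ rs) ! Suc i)" if "Suc i < m" for i
    proof (cases "i < length bs")
      case True
      then show ?thesis using adj(2)[OF True] len by (simp add: nth_append)
    next
      case False
      then show ?thesis using complete inX inY that by (metis adj_sym Suc_lessD not_less)
    qed
  qed
  with no_path show False by blast
qed

text \<open>The t non-neighbours L of x have all their neighbours among the t+1 vertices N adjacent
  to y. Between L and N so few edges are missing that a path starts at u, runs through L with y
  last, and leaves y for the one possibly bad vertex a of N; \<open>alt_path_prefix\<close>
  completes it. The equality clause supplies u in N and v outside L.\<close>

lemma no_tight_pair:
  assumes xy: "x \<in> X" "y \<in> Y" "\<not> adj E x y" and d: "dY y = t + 1" "dX x = m - t"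
  shows False
proof -
  define L where "L = Y - nbs E Y x"
  define N where "N = nbs E X y"
  have fL: "finite L" "L \<subseteq> Y" "card L = t"
    using fin card_non_nbs d m_gt by (auto simp: L_def)
  have fN: "finite N" "N \<subseteq> X" "card N = t + 1"
    using d nbs_sub by (auto simp: N_def)
  have yL: "y \<in> L" using xy by (auto simp: L_def nbs_def)
  have "dX x + dY y = m + 1" using d m_gt by auto
  then have "adj E x v" "adj E u y" using closed_eq xy by auto
  then have uN: "u \<in> N" and vL: "v \<notin> L"
    using uX vY by (auto simp: N_def L_def nbs_def adj_sym)
  have dL: "dY y0 \<le> t + 1" if "y0 \<in> L" for y0
    using closed[of x y0] that d xy m_gt by (auto simp: L_def nbs_def)
  \<comment> \<open>A missing edge outside L would force at least t(m-t-1) + m - t - 2 missing edges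
    by \<open>cross_bound\<close>, which is t more than (t+1)(m-t-2).\<close>
  have complete: "adj E x0 y0" if "x0 \<in> X" "y0 \<in> Y - L" for x0 y0
  proof (rule ccontr)
    assume "\<not> adj E x0 y0"
    then have "t * (m - (t + 1)) + m \<le> card non_edges + t + 2"
      using cross_bound[of L "t + 1" x0 y0] fL dL that by auto
    moreover obtain z where "m = t + 3 + z"
      using m_gt le_Suc_ex[of "t + 3" m] by auto
    ultimately show False using miss by (simp add: algebra_simps)
  qed
  \<comment> \<open>A vertex outside N is not adjacent to y, so its degree is at most m - t; the m -
    t vertices of Y - L already exhaust it.\<close>
  have out: "\<not> adj E x' y0" if "x' \<in> X - N" "y0 \<in> L" for x' y0
  proof -
    have "\<not> adj E x' y" using that by (auto simp: N_def nbs_def adj_sym)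
    then have le: "dX x' \<le> m - t" using closed[of x' y] xy d that by auto
    have "Y - L \<subseteq> nbs E Y x'" using complete that by (auto simp: nbs_def)
    moreover have "card (Y - L) = m - t" using fL cardXY by (simp add: card_Diff_subset)
    ultimately have "Y - L = nbs E Y x'"
      using le by (intro card_seteq) auto
    then show ?thesis using that fL by (auto simp: nbs_def)
  qed
  have nbL: "nbs E X y0 \<subseteq> N" if "y0 \<in> L" for y0
    using out that by (auto simp: nbs_def adj_sym)
  \<comment> \<open>If a in N misses some \<open>y0\<close> in L, then \<open>closed\<close> bounds
    the degree of a by m+1-t, so a misses at least t-1 vertices of L, that is, all of L - {y}.
    Equality then holds for (a, y0), so u is adjacent to \<open>y0\<close> and a differs from u.
    Each vertex of L - {y} needs t neighbours inside N - {a}, hence is joined to all of it.\<close>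
  have "\<exists>a. a \<in> N - {u} \<and> (\<forall>y0\<in>L - {y}. N - {a} \<subseteq> nbs E X y0)"
  proof (cases "\<forall>y0\<in>L. N \<subseteq> nbs E X y0")
    case True
    have "card (N - {u}) > 0" using fN uN t1 by simp
    then have "N - {u} \<noteq> {}" by (metis card.empty less_irrefl)
    then show ?thesis using True by blast
  next
    case False
    then obtain y0 a where a: "y0 \<in> L" "a \<in> N" "\<not> adj E a y0"
      using fN by (auto simp: nbs_def adj_sym)
    define J where "J = L - nbs E Y a"
    have "Y - J \<subseteq> nbs E Y a" using complete a fN by (auto simp: J_def nbs_def)
    then have "m - card J \<le> dX a"
      using card_mono[of "nbs E Y a" "Y - J"] fL cardXY finite_subset[of J L]
      by (simp add: card_Diff_subset J_def subset_eq)
    moreover have "dX a + dY y0 \<le> m + 1" using closed a fL fN by auto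
    moreover have "t \<le> dY y0" using minY a fL by auto
    moreover have yJ: "J \<subseteq> L - {y}" using a xy by (auto simp: J_def N_def nbs_def adj_sym)
    moreover have cLy: "card (L - {y}) = t - 1" using yL fL by simp
    moreover have "card J \<le> t - 1" using card_mono[OF _ yJ] cLy fL by auto
    ultimately have cJ: "card J = t - 1" and sum: "dX a + dY y0 = m + 1"
      using m_gt t1 by linarith+
    have J: "J = L - {y}" using cJ cLy yJ fL by (intro card_subset_eq) auto
    have "adj E u y0" using closed_eq[of a y0] sum a fL fN by auto
    then have "a \<noteq> u" using a by auto
    moreover have "N - {a} \<subseteq> nbs E X y1" if "y1 \<in> L - {y}" for y1
    proof -
      have "y1 \<in> J" using that J by auto
      then have "\<not> adj E a y1" using fL by (auto simp: J_def nbs_def)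
      then have "a \<notin> nbs E X y1" by (auto simp: nbs_def adj_sym)
      then have "nbs E X y1 \<subseteq> N - {a}" using nbL[of y1] that by auto
      moreover have "card (N - {a}) = t" using a fN by simp
      moreover have "t \<le> dY y1" using minY that fL by auto
      ultimately have "nbs E X y1 = N - {a}" using fN by (intro card_seteq) auto
      then show ?thesis by simp
    qed
    ultimately show ?thesis using a by blast
  qed
  then obtain a where a: "a \<in> N" "a \<noteq> u" "\<And>y0. y0 \<in> L - {y} \<Longrightarrow> N - {a} \<subseteq> nbs E X y0"
    by blast
  obtain ns where ns: "set ns = N - {u, a}" "distinct ns"
    using finite_distinct_list[of "N - {u, a}"] fN by auto
  obtain ls where ls: "set ls = L - {y}" "distinct ls"
    using finite_distinct_list[of "L - {y}"] fL by auto
  have lns: "length ns = t - 1"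
    using ns a uN fN distinct_card[OF ns(2)] by (simp add: card_Diff_subset)
  have lls: "length ls = t - 1"
    using ls yL fL distinct_card[OF ls(2)] by simp
  have asN: "(u # ns @ [a]) ! i \<in> N" if "i \<le> t" for i
  proof -
    have "(u # ns @ [a]) ! i \<in> set (u # ns @ [a])" using that lns t1 by (intro nth_mem) auto
    then show ?thesis using ns a uN by auto
  qed
  have asN': "(u # ns @ [a]) ! i \<in> N - {a}" if "i < t" for i
  proof -
    have "(u # ns @ [a]) ! i = (u # ns) ! i" using that lns t1
      by (cases i) (auto simp: nth_append)
    moreover have "(u # ns) ! i \<in> set (u # ns)" using that lns t1 by (intro nth_mem) auto
    ultimately show ?thesis using ns a uN by auto
  qed
  have lsL: "ls ! i \<in> L - {y}" if "i < t - 1" for i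
    using that ls lls by (metis nth_mem)
  have ok: "w \<in> nbs E X ((ls @ [y]) ! i)"
    if "w = (u # ns @ [a]) ! j" "i < t" "j \<le> Suc i" for w i j
  proof (cases "i < t - 1")
    case True
    then have "N - {a} \<subseteq> nbs E X ((ls @ [y]) ! i)"
      using a(3)[OF lsL[OF True]] lls by (simp add: nth_append)
    moreover have "w \<in> N - {a}" using asN'[of j] that True by simp
    ultimately show ?thesis by blast
  next
    case False
    then have "(ls @ [y]) ! i = y" using that lls by (simp add: nth_append)
    then show ?thesis using asN[of j] that by (simp add: N_def)
  qed
  show False
  proof (rule alt_path_prefix[of "u # ns @ [a]" "ls @ [y]"])
    show "adj E ((u # ns @ [a]) ! i) ((ls @ [y]) ! i)" if "i < length (ls @ [y])" for i
      using nbs_adjD(1)[OF ok[OF refl, of i i]] that lls t1 by simp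
    show "adj E ((ls @ [y]) ! i) ((u # ns @ [a]) ! Suc i)" if "i < length (ls @ [y])" for i
      using nbs_adjD(2)[OF ok[OF refl, of i "Suc i"]] that lls t1 by simp
    show "adj E x0 y0" if "x0 \<in> X" "y0 \<in> Y - set (ls @ [y])" for x0 y0
      by (rule complete[OF that(1)]) (use that ls yL in auto)
    show "distinct (u # ns @ [a])" "distinct (ls @ [y])" using ns ls a by auto
    show "set (u # ns @ [a]) \<subseteq> X" using ns a(1) uX fN(2) by auto
    show "set (ls @ [y]) \<subseteq> Y - {v}" using ls fL(2) yL vL by auto
    show "length (u # ns @ [a]) = length (ls @ [y]) + 1" using lns lls by simp
  qed simp_all
qed

lemma max_degree_sum_pair:
  assumes "S \<subseteq> non_edges" "S \<noteq> {}"
  obtains x y where "(x, y) \<in> S" "\<And>x1 y1. (x1, y1) \<in> S \<Longrightarrow> dX x1 + dY y1 \<le> dX x + dY y"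
proof -
  let ?f = "\<lambda>(a, b). dX a + dY b"
  have "finite S" using assms fin_non_edges finite_subset by blast
  then have "Max (?f ` S) \<in> ?f ` S" using assms by (intro Max_in) auto
  then obtain x y where xy: "(x, y) \<in> S" "?f (x, y) = Max (?f ` S)" by force
  have "?f (x1, y1) \<le> ?f (x, y)" if "(x1, y1) \<in> S" for x1 y1
    unfolding xy(2) using \<open>finite S\<close> that by (intro Max_ge imageI finite_imageI)
  then show thesis using that[of x y] xy(1) by simp
qed

text \<open>B and N span a complete bipartite graph with t-1 and t vertices, so a path from u in N
  can alternate through all of it and end in N, ready for \<open>alt_path_prefix\<close>.\<close>

lemma incomplete_outside:
  assumes B: "B \<subseteq> Y - {v}" "card B = t - 1" and N: "card N = t" "u \<in> N" "N \<subseteq> X"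
    and sub: "\<And>y. y \<in> B \<Longrightarrow> N \<subseteq> nbs E X y"
    and complete: "\<And>x y. x \<in> X \<Longrightarrow> y \<in> Y - B \<Longrightarrow> adj E x y"
  shows False
proof -
  have fB: "finite B" "finite N" using B N fin finite_subset by blast+
  obtain ns where ns: "set ns = N - {u}" "distinct ns"
    using finite_distinct_list[of "N - {u}"] fB by auto
  obtain ls where ls: "set ls = B" "distinct ls"
    using finite_distinct_list[of B] fB by auto
  have lns: "length ns = t - 1"
    using ns N fB distinct_card[OF ns(2)] by simp
  have lls: "length ls = t - 1"
    using ls B distinct_card[OF ls(2)] by simp
  have ok: "(u # ns) ! j \<in> nbs E X (ls ! i)" if "j < t" "i < t - 1" for i j
  proof -
    have "(u # ns) ! j \<in> set (u # ns)" using that lns by (intro nth_mem) auto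
    then have "(u # ns) ! j \<in> N" using ns N by auto
    moreover have "ls ! i \<in> B" using that ls(1) lls nth_mem[of i ls] by simp
    ultimately show ?thesis using subsetD[OF sub] by simp
  qed
  show False
  proof (rule alt_path_prefix[of "u # ns" ls])
    show "adj E ((u # ns) ! i) (ls ! i)" if "i < length ls" for i
      using nbs_adjD(1)[OF ok[of i i]] that lls by simp
    show "adj E (ls ! i) ((u # ns) ! Suc i)" if "i < length ls" for i
      using nbs_adjD(2)[OF ok[of "Suc i" i]] that lls by simp
    show "adj E x0 y0" if "x0 \<in> X" "y0 \<in> Y - set ls" for x0 y0
      by (rule complete[OF that(1)]) (use that ls in auto)
    show "distinct (u # ns)" "distinct ls" using ns ls by auto
    show "set (u # ns) \<subseteq> X" using ns N by auto
    show "set ls \<subseteq> Y - {v}" using ls B by auto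
    show "length (u # ns) = length ls + 1" using lns lls by simp
  qed simp_all
qed

text \<open>If \<open>x0\<close> and y were not adjacent, each would have a second neighbour to
  route through: with a next to y and b next to \<open>x0\<close>, the order u, y, a, ..., b, x0, v
  gives a full path, the middle part lying in the complete remainder.\<close>

lemma low_vertices_adjacent:
  assumes x0: "x0 \<in> X" "x0 \<noteq> u" "adj E x0 v" "dX x0 = 2"
    and y: "y \<in> Y" "y \<noteq> v" "adj E u y" "dY y = 2"
    and complete: "\<And>x1 y1. x1 \<in> X - {x0} \<Longrightarrow> y1 \<in> Y - {y} \<Longrightarrow> adj E x1 y1"
  shows "adj E x0 y"
proof (rule ccontr)
  assume na: "\<not> adj E x0 y"
  have "u \<in> nbs E X y" "v \<in> nbs E Y x0" using x0 y uX vY by (auto simp: nbs_def adj_sym)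
  then have "card (nbs E X y - {u}) = 1" "card (nbs E Y x0 - {v}) = 1" using x0 y by auto
  then obtain a b where "nbs E X y - {u} = {a}" "nbs E Y x0 - {v} = {b}"
    by (auto simp: card_1_singleton_iff)
  then have ab: "a \<in> nbs E X y" "a \<noteq> u" "b \<in> nbs E Y x0" "b \<noteq> v" by auto
  then have a: "a \<in> X" "adj E y a" "a \<noteq> x0" and b: "b \<in> Y" "adj E b x0" "b \<noteq> y"
    using na nbs_adjD[OF ab(1)] nbs_adjD[OF ab(3)] by auto
  obtain rs where rs: "set rs = X - {u, a, x0}" "distinct rs"
    using finite_distinct_list[of "X - {u, a, x0}"] fin by auto
  obtain qs where qs: "set qs = Y - {y, b, v}" "distinct qs"
    using finite_distinct_list[of "Y - {y, b, v}"] fin by auto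
  let ?as = "u # a # rs @ [x0]" let ?bs = "y # qs @ [b, v]"
  have d1: "distinct ?as" "set ?as = X" using rs a ab x0 uX by auto
  have d2: "distinct ?bs" "set ?bs = Y" using qs b ab y vY by auto
  have l1: "length ?as = m" using d1 cardXY by (metis distinct_card)
  have l2: "length ?bs = m" using d2 cardXY by (metis distinct_card)
  have inX: "?as ! i \<in> X - {x0}" if i: "i < m - 1" for i
  proof -
    have "?as ! i = (u # a # rs) ! i" using i l1 nth_append[of "u # a # rs" "[x0]" i] by auto
    moreover have "(u # a # rs) ! i \<in> set (u # a # rs)" using i l1 by (intro nth_mem) auto
    moreover have "set (u # a # rs) = X - {x0}" using rs a(1,3) x0(2) uX by auto
    ultimately show ?thesis by metis
  qed
  have inY: "?bs ! i \<in> Y - {y}" if i: "0 < i" "i < m" for i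
  proof -
    have "?bs ! i = (qs @ [b, v]) ! (i - 1)" using i by (simp add: nth_Cons')
    moreover have "(qs @ [b, v]) ! (i - 1) \<in> set (qs @ [b, v])"
      using i l2 by (intro nth_mem) auto
    moreover have "set (qs @ [b, v]) = Y - {y}" using qs b(1,3) y(2) vY by auto
    ultimately show ?thesis by metis
  qed
  have asl: "?as ! (m - 1) = x0"
  proof -
    have "m - 1 = length (u # a # rs)" using l1 by simp
    then show ?thesis by (metis append_Cons nth_append_length)
  qed
  have bsl: "?bs ! (m - 1) = v"
  proof -
    have "m - 1 = length (y # qs @ [b])" using l2 by simp
    then show ?thesis by (metis append_Cons append.assoc append_Nil nth_append_length)
  qed
  have bsl': "?bs ! (m - 2) = b"
  proof -
    have "m - 2 = length (y # qs)" using l2 by simp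
    then show ?thesis by (metis append_Cons nth_append_length)
  qed
  have "\<exists>c. alt_path X Y E u v m c"
  proof (rule alt_path_of_lists[OF disj d1 l1 d2 l2])
    show "m > 0" "?as ! 0 = u" "?bs ! (m - 1) = v" using m_gt bsl by auto
    show "adj E (?as ! i) (?bs ! i)" if i: "i < m" for i
    proof -
      consider "i = 0" | "0 < i" "i < m - 1" | "i = m - 1" using i by linarith
      then show ?thesis
      proof cases
        case 1 then show ?thesis using y by simp
      next
        case 2
        show ?thesis by (rule complete[OF inX inY]) (use 2 i in simp_all)
      next
        case 3 then show ?thesis using x0 asl bsl by simp
      qed
    qed
    show "adj E (?bs ! i) (?as ! Suc i)" if i: "Suc i < m" for i
    proof -
      consider "i = 0" | "0 < i" "Suc i < m - 1" | "i = m - 2" using i by linarith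
      then show ?thesis
      proof cases
        case 1 then show ?thesis using a by simp
      next
        case 2
        have "adj E (?as ! Suc i) (?bs ! i)"
          by (rule complete[OF inX inY]) (use 2 i in simp_all)
        then show ?thesis by (subst adj_sym)
      next
        case 3
        then have "Suc i = m - 1" using i by simp
        then have "?as ! Suc i = x0" using asl by metis
        then show ?thesis using b bsl' 3 by metis
      qed
    qed
  qed
  with no_path show False by (rule notE)
qed

text \<open>One missing pair off the cross of \<open>x0\<close> and y is too expensive: y misses m-2
  vertices, \<open>x0\<close> at least m-3 more, and the ends of the new pair at least m-4 more, in
  total 3m-9 against a budget of 3(m-4).\<close>

lemma complete_off_cross:
  assumes t: "t = 2" and x0: "x0 \<in> X" "dX x0 = 2" and y: "y \<in> Y" "dY y = 2"
    and xy1: "x1 \<in> X - {x0}" "y1 \<in> Y - {y}"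
  shows "adj E x1 y1"
proof (rule ccontr)
  assume na: "\<not> adj E x1 y1"
  define R0 where "R0 = Y - {y} - nbs E Y x0"
  define R where "R = Y - {y} - nbs E Y x1"
  define K where "K = X - {x0} - nbs E X y1"
  have fR: "finite R0" "finite R" "finite K" using fin by (auto simp: R0_def R_def K_def)
  have "Y \<subseteq> nbs E Y x0 \<union> {y} \<union> R0" by (auto simp: R0_def)
  then have "m \<le> card (nbs E Y x0 \<union> {y} \<union> R0)"
    using cardXY fR by (metis card_mono fin_nbs(2) finite_Un finite.emptyI finite.insertI)
  also have "\<dots> \<le> dX x0 + 1 + card R0"
    using card_Un_le[of "nbs E Y x0 \<union> {y}" R0] card_Un_le[of "nbs E Y x0" "{y}"] by simp
  finally have 0: "m \<le> card R0 + 3" using x0 by simp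
  have "Y \<subseteq> nbs E Y x1 \<union> {y} \<union> R" by (auto simp: R_def)
  then have "m \<le> card (nbs E Y x1 \<union> {y} \<union> R)"
    using cardXY fR by (metis card_mono fin_nbs(2) finite_Un finite.emptyI finite.insertI)
  also have "\<dots> \<le> dX x1 + 1 + card R"
    using card_Un_le[of "nbs E Y x1 \<union> {y}" R] card_Un_le[of "nbs E Y x1" "{y}"] by simp
  finally have 1: "m \<le> dX x1 + 1 + card R" .
  have "X \<subseteq> nbs E X y1 \<union> {x0} \<union> K" by (auto simp: K_def)
  then have "m \<le> card (nbs E X y1 \<union> {x0} \<union> K)"
    using cardXY fR by (metis card_mono fin_nbs(1) finite_Un finite.emptyI finite.insertI)
  also have "\<dots> \<le> dY y1 + 1 + card K"
    using card_Un_le[of "nbs E X y1 \<union> {x0}" K] card_Un_le[of "nbs E X y1" "{x0}"] by simp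
  finally have 2: "m \<le> dY y1 + 1 + card K" .
  have 3: "dX x1 + dY y1 \<le> m + 1" using closed na xy1 by auto
  let ?C1 = "{x1} \<times> R \<union> K \<times> {y1}"
  have "{x1} \<times> R \<inter> K \<times> {y1} = {(x1, y1)}"
    using xy1 na by (auto simp: R_def K_def nbs_def adj_sym)
  then have 4: "card ?C1 + 1 = card R + card K"
    using card_Un_Int[of "{x1} \<times> R" "K \<times> {y1}"] fR by (simp add: card_cartesian_product)
  have 5: "card ({x0} \<times> R0 \<union> ?C1) = card R0 + card ?C1"
    using fR xy1 by (subst card_Un_disjoint) (auto simp: card_cartesian_product K_def)
  have "card {y} * (m - 2) + card ({x0} \<times> R0 \<union> ?C1) \<le> card non_edges"
    by (rule non_edges_bound) (use xy1 x0 y in \<open>auto simp: R0_def R_def K_def nbs_def adj_sym\<close>)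
  then have "m - 2 + (card R0 + card ?C1) \<le> card non_edges" using 5 by simp
  then show False using miss 0 1 2 3 4 m_gt t by auto
qed

text \<open>The first two alternatives lead to the extremal graph. The third collects the forced
  path u, y, x, v, which arises only for t = 2 and has to be excluded spectrally.\<close>

abbreviation "low_structure \<equiv>
  (\<exists>T\<subseteq>X. card T = t \<and> (\<forall>x\<in>T. dX x \<le> t)) \<or>
  (\<exists>T\<subseteq>Y. card T = t \<and> (\<forall>y\<in>T. dY y \<le> t)) \<or>
  (t = 2 \<and> (\<exists>x\<in>X. \<exists>y\<in>Y. adj E x y \<and> dX x \<le> 2 \<and> dY y \<le> 2))"

text \<open>Here x has only t-1 non-neighbours L, one low vertex short. If nothing is missing
  outside L, all of L has the same t neighbours and \<open>incomplete_outside\<close> applies.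
  Otherwise a missing pair outside L of maximal degree sum either supplies the t-th low vertex or
  leads to the t = 2 configuration.\<close>

lemma low_structure_degree_t:
  assumes xy: "x \<in> X" "y \<in> Y" "\<not> adj E x y" and d: "dY y = t" "dX x = m + 1 - t"
  shows low_structure
proof -
  define L where "L = Y - nbs E Y x"
  have fL: "finite L" "L \<subseteq> Y" using fin by (auto simp: L_def)
  have cL: "card L = t - 1" using card_non_nbs(1)[of x] d m_gt t1 by (simp add: L_def)
  have yL: "y \<in> L" using xy by (auto simp: L_def nbs_def)
  have t2: "t \<ge> 2"
  proof -
    have "card L > 0" using yL fL card_gt_0_iff by blast
    then show ?thesis using cL by simp
  qed
  have "dX x + dY y = m + 1" using d m_gt by auto
  then have av: "adj E x v" "adj E u y" using closed_eq xy by auto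
  then have vL: "v \<notin> L" using vY by (auto simp: L_def nbs_def)
  have dL: "dY y1 \<le> t" if "y1 \<in> L" for y1
    using closed[of x y1] that d xy m_gt t1 by (auto simp: L_def nbs_def)
  show ?thesis
  proof (cases "\<forall>x0\<in>X. \<forall>y0\<in>Y - L. adj E x0 y0")
    case True
    define N where "N = nbs E X y"
    have N: "card N = t" "u \<in> N" "N \<subseteq> X" "finite N"
      using d av uX nbs_sub(1)[of y] fin_nbs(1)[of y] adj_sym[of E u y] unfolding N_def
      by (simp_all add: nbs_def)
    have "N = nbs E X y1" if y1: "y1 \<in> L" for y1
    proof -
      have "\<not> adj E x' y1" if x': "x' \<in> X - N" for x'
      proof -
        have "\<not> adj E x' y" using x' by (auto simp: N_def nbs_def adj_sym)
        then have le: "dX x' \<le> m + 1 - t" using closed[of x' y] xy d x' by auto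
        have "Y - L \<subseteq> nbs E Y x'" using True x' by (auto simp: nbs_def)
        moreover have "card (Y - L) = m - (t - 1)" using fL cardXY cL by (simp add: card_Diff_subset)
        ultimately have "Y - L = nbs E Y x'"
          using le t1 by (intro card_seteq) auto
        then show ?thesis using y1 fL by (auto simp: nbs_def)
      qed
      then have "nbs E X y1 \<subseteq> N" by (auto simp: nbs_def adj_sym)
      moreover have "t \<le> dY y1" using minY y1 fL by auto
      ultimately show ?thesis using N by (metis card_seteq)
    qed
    then have False
      using incomplete_outside[of L N] N fL cL vL True by blast
    then show ?thesis ..
  next
    case False
    define S where "S = {(x0, y0). x0 \<in> X \<and> y0 \<in> Y - L \<and> \<not> adj E x0 y0}"
    have "S \<subseteq> non_edges" "S \<noteq> {}" using False by (auto simp: S_def)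
    then obtain x0 y0 where q: "(x0, y0) \<in> S"
      "\<And>x1 y1. (x1, y1) \<in> S \<Longrightarrow> dX x1 + dY y1 \<le> dX x0 + dY y0"
      by (rule max_degree_sum_pair) blast
    have q0: "x0 \<in> X" "y0 \<in> Y - L" "\<not> adj E x0 y0" using q(1) by (auto simp: S_def)
    define R where "R = Y - L - nbs E Y x0"
    define r where "r = card R"
    have fR: "finite R" "R \<subseteq> Y" using fin by (auto simp: R_def)
    have y0R: "y0 \<in> R" using q0 by (auto simp: R_def nbs_def)
    then have r1: "r \<ge> 1" using fR r_def by (metis card_gt_0_iff empty_iff less_eq_Suc_le One_nat_def)
    have dR: "dY y1 \<le> dY y0" if "y1 \<in> R" for y1
    proof -
      have "(x0, y1) \<in> S" using that q0 by (auto simp: S_def R_def nbs_def)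
      from q(2)[OF this] show ?thesis by simp
    qed
    have "Y \<subseteq> nbs E Y x0 \<union> L \<union> R" by (auto simp: R_def)
    then have "m \<le> card (nbs E Y x0 \<union> L \<union> R)"
      using cardXY fL fR by (metis card_mono fin_nbs(2) finite_Un)
    also have "\<dots> \<le> dX x0 + card L + card R"
      by (meson card_Un_le le_trans add_le_mono1)
    finally have a: "m \<le> dX x0 + (t - 1) + r" using cL r_def by simp
    have ab: "dX x0 + dY y0 \<le> m + 1" using closed q0 by auto
    have ta: "t \<le> dX x0" using minX q0 by auto
    have "card L * (m - t) + card (non_edges \<inter> X \<times> R) \<le> card non_edges"
      by (rule non_edges_bound) (use fL dL in \<open>auto simp: R_def\<close>)
    moreover have "r * (m - dY y0) \<le> card (non_edges \<inter> X \<times> R)"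
      unfolding r_def by (rule non_edges_column) (use fR dR in auto)
    ultimately have mu: "(t - 1) * (m - t) + r * (m - dY y0) < (t + 1) * (m - t - 2)"
      using miss unfolding cL by linarith
    obtain z where z: "m = t + 2 + z" using m_gt le_Suc_ex[of "t + 2" m] by auto
    have mz: "m - t = z + 2" "m - t - 2 = z" using z by auto
    obtain t' where t': "t = Suc (Suc t')" using t2 by (metis add_2_eq_Suc le_Suc_ex)
    \<comment> \<open>By \<open>closed\<close> each of the r vertices in R misses at least z+2-r
      vertices, and beyond L the budget leaves less than 2z-2t+2. The concave product r(z+2-r) is at
      least 2z for r between 2 and z, so only the two ends of the range survive.\<close>
    consider "r = 1" | "2 \<le> r" "r \<le> z" | "r \<ge> z + 1" using r1 by linarith
    then show ?thesis
    proof cases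
      case 1
      have "dX x0 \<ge> m - t" using a 1 t1 by simp
      show ?thesis
      proof (cases "dY y0 = t + 1")
        case True
        then have "dX x0 = m - t" using ab \<open>dX x0 \<ge> m - t\<close> m_gt by auto
        then have False using no_tight_pair[of x0 y0] q0 True by auto
        then show ?thesis ..
      next
        case False
        then have "dY y0 \<le> t" using ab \<open>dX x0 \<ge> m - t\<close> m_gt by auto
        then have "\<forall>y1\<in>insert y0 L. dY y1 \<le> t" using dL by auto
        moreover have "card (insert y0 L) = t" using q0 cL fL t1 by simp
        moreover have "insert y0 L \<subseteq> Y" using q0 fL by auto
        ultimately show ?thesis by blast
      qed
    next
      case 2
      then obtain r' w where rw: "r = r' + 2" "z = r' + 2 + w"
        by (metis add.commute le_Suc_ex)
      have "m - dY y0 \<ge> w + 2" using a ab rw mz z d_le(2)[of y0] t1 by linarith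
      then have "(t - 1) * (m - t) + r * (w + 2) < (t + 1) * (m - t - 2)"
        using mu by (metis add_le_cancel_left le_less_trans mult_le_mono2)
      then have "(t' + 1) * (r' + 2 + w + 2) + (r' + 2) * (w + 2) < (t' + 3) * (r' + 2 + w)"
        unfolding mz rw by (simp add: t')
      then have False by (simp add: algebra_simps)
      then show ?thesis ..
    next
      case 3
      have "m - dY y0 \<ge> dX x0 - 1" using ab d_le(2)[of y0] by linarith
      then have "(z + 1) * (dX x0 - 1) \<le> r * (m - dY y0)" using 3 by (intro mult_le_mono) auto
      then have mu': "(t - 1) * (z + 2) + (z + 1) * (dX x0 - 1) < (t + 1) * z"
        using mu mz by simp
      obtain a' where a': "dX x0 = t + a'" using ta le_Suc_ex by blast
      \<comment> \<open>With t = t'+2 and dX x0 = t+a' the count reads (z+1)(t'+a'+1) < 2z-2t'-2,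
        which fails as soon as t'+a' is positive. This is where t = 2 is singled out.\<close>
      have "t' = 0 \<and> a' = 0"
      proof (rule ccontr)
        assume "\<not> (t' = 0 \<and> a' = 0)"
        then have ge: "1 \<le> t' + a'" by linarith
        have "z + 1 \<le> (z + 1) * (t' + a')" using mult_le_mono2[OF ge, of "z + 1"] by simp
        then show False using mu' unfolding a' t' by (simp add: algebra_simps)
      qed
      then have t: "t = 2" and d0: "dX x0 = 2" using t' a' by auto
      have "L = {y}" using cL t yL by (metis One_nat_def card_1_singletonE diff_Suc_1 numeral_2_eq_2 singletonD)
      have complete: "adj E x1 y1" if "x1 \<in> X - {x0}" "y1 \<in> Y - {y}" for x1 y1
        using complete_off_cross[of x0 y x1 y1] t d0 q0 xy d that by auto
      \<comment> \<open>Now \<open>y0\<close> misses only \<open>x0\<close>, so its degree is at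
        least m-1 and the degree sum attains m+1; the equality clause then joins \<open>x0\<close>
        to v.\<close>
      have "X - {x0} \<subseteq> nbs E X y0"
        using complete q0 \<open>L = {y}\<close> by (auto simp: nbs_def adj_sym)
      then have "m - 1 \<le> dY y0"
        using card_mono[of "nbs E X y0" "X - {x0}"] q0 cardXY fin by simp
      then have "dX x0 + dY y0 = m + 1" using ab d0 by simp
      then have "adj E x0 v" "adj E u y0" using closed_eq q0 by auto
      then have "adj E x0 y"
        using low_vertices_adjacent[of x0 y] q0 d0 d t xy yL vL av complete by auto
      moreover have "dX x0 \<le> 2" "dY y \<le> 2" using d0 d t by auto
      ultimately show ?thesis using t q0(1) xy(2) by blast
    qed
  qed
qed

text \<open>By maximality all m - dX x non-neighbours of x have degree at most dY y, so (m - dX x)(m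
  - dY y) pairs are missing. With the smaller degree written as t+i, the budget excludes i \<ge> 2
  at degree sum m+1 and i \<ge> 1 at sum at most m. The cases i = 0 and i = 1 at sum m+1 fit the
  budget and need paths: \<open>low_structure_degree_t\<close> and
  \<open>no_tight_pair\<close>.\<close>

lemma low_structure_max_pair:
  assumes xy: "x \<in> X" "y \<in> Y" "\<not> adj E x y" and le: "dY y \<le> dX x"
    and mx: "\<And>x1 y1. x1 \<in> X \<Longrightarrow> y1 \<in> Y \<Longrightarrow> \<not> adj E x1 y1 \<Longrightarrow> dX x1 + dY y1 \<le> dX x + dY y"
  shows low_structure
proof -
  define L where "L = Y - nbs E Y x"
  have fL: "finite L" "L \<subseteq> Y" "card L = m - dX x"
    using fin card_non_nbs by (auto simp: L_def)
  have dL: "dY y1 \<le> dY y" if "y1 \<in> L" for y1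
    using mx[of x y1] that xy by (auto simp: L_def nbs_def)
  have "card L * (m - dY y) + card ({} :: ('a \<times> 'a) set) \<le> card non_edges"
    by (rule non_edges_bound) (use fL dL in auto)
  then have mu: "(m - dX x) * (m - dY y) < (t + 1) * (m - t - 2)"
    using miss fL by simp
  have ty: "t \<le> dY y" using minY xy by auto
  have sum: "dX x + dY y \<le> m + 1" using closed xy by auto
  obtain z where z: "m = t + 2 + z" using m_gt le_Suc_ex[of "t + 2" m] by auto
  have mz: "m - t - 2 = z" using z by auto
  obtain i where i: "dY y = t + i" using ty le_Suc_ex by blast
  show ?thesis
  proof (cases "dX x + dY y = m + 1")
    case True
    consider "i = 0" | "i = 1" | "i \<ge> 2" by linarith
    then show ?thesis
    proof cases
      case 1
      then show ?thesis using low_structure_degree_t[OF xy] i True by auto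
    next
      case 2
      then have False using no_tight_pair[OF xy] i True by auto
      then show ?thesis ..
    next
      case 3
      then obtain j where j: "i = j + 2" by (metis add.commute le_Suc_ex)
      have "m - dY y = dX x - 1" "m - dX x = t + 1 + j" using True i j d_le[of x] by auto
      moreover obtain w where w: "dX x = t + j + 2 + w" using le i j le_Suc_ex[of "t+i" "dX x"] by auto
      moreover have "z = t + 2 * j + w + 1" using z True i j w by auto
      \<comment> \<open>The left side exceeds the right one by j(j+w), so the strict inequality is
        impossible.\<close>
      ultimately have "(t + 1 + j) * (t + j + 1 + w) < (t + 1) * (t + 2 * j + w + 1)"
        using mu mz by simp
      then have False by (simp add: algebra_simps)
      then show ?thesis ..
    qed
  next
    case False
    then have sum: "dX x + dY y \<le> m" using sum by simp
    have i0: "i = 0"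
    proof (rule ccontr)
      assume "i \<noteq> 0"
      then obtain j where j: "i = Suc j" by (metis not0_implies_Suc)
      obtain g where g: "m = dX x + dY y + g" using sum le_Suc_ex by blast
      obtain w where w: "dX x = t + Suc j + w" using le i j le_Suc_ex[of "t+i" "dX x"] by auto
      have "m - dX x = t + Suc j + g" "m - dY y = t + Suc j + w + g" using g i j w by auto
      moreover have "z = t + 2 * j + w + g" using z g i j w by auto
      ultimately have "(t + Suc j + g) * (t + Suc j + w + g) < (t + 1) * (t + 2 * j + w + g)"
        using mu mz by simp
      then show False by (simp add: algebra_simps)
    qed
    obtain g where g: "m = dX x + dY y + g" using sum le_Suc_ex by blast
    have "m - dX x = t + g" "m - dY y = z + 2" using g i i0 z by auto
    then have *: "(t + g) * (z + 2) < (t + 1) * z" using mu mz by simp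
    have "g = 0"
    proof (rule ccontr)
      assume "g \<noteq> 0"
      then have "(t + 1) * (z + 2) \<le> (t + g) * (z + 2)" by (intro mult_le_mono) auto
      then show False using * by (simp add: algebra_simps)
    qed
    then have "card L = t" using fL \<open>m - dX x = t + g\<close> by simp
    moreover have "\<forall>y1\<in>L. dY y1 \<le> t" using dL i i0 by auto
    ultimately show ?thesis using fL by blast
  qed
qed

theorem low_structure_closed: low_structure
proof -
  have "non_edges \<noteq> {}"
  proof
    assume "non_edges = {}"
    then have "adj E x y" if "x \<in> X" "y \<in> Y" for x y using that by auto
    then show False using alt_path_prefix[of "[u]" "[]"] uX by auto
  qed
  with order_refl obtain x y where q: "(x, y) \<in> non_edges"
    "\<And>x1 y1. (x1, y1) \<in> non_edges \<Longrightarrow> dX x1 + dY y1 \<le> dX x + dY y"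
    by (rule max_degree_sum_pair) blast
  have q0: "x \<in> X" "y \<in> Y" "\<not> adj E x y" using q(1) by auto
  have mx: "dX x1 + dY y1 \<le> dX x + dY y" if "x1 \<in> X" "y1 \<in> Y" "\<not> adj E x1 y1" for x1 y1
    using q(2)[of x1 y1] that by simp
  show ?thesis
  proof (cases "dY y \<le> dX x")
    case True
    then show ?thesis using low_structure_max_pair[OF q0 True mx] by blast
  next
    case False
    interpret sw: closed_bigraph Y X E v u m t by (rule swap)
    have "\<not> adj E y x" using q0 by (simp add: adj_sym)
    moreover have "dY y1 + dX x1 \<le> dY y + dX x" if "y1 \<in> Y" "x1 \<in> X" "\<not> adj E y1 x1" for x1 y1
      using mx[of x1 y1] that by (simp add: adj_sym add.commute)
    ultimately have "(\<exists>T\<subseteq>Y. card T = t \<and> (\<forall>y\<in>T. dY y \<le> t)) \<or>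
      (\<exists>T\<subseteq>X. card T = t \<and> (\<forall>x\<in>T. dX x \<le> t)) \<or>
      (t = 2 \<and> (\<exists>y\<in>Y. \<exists>x\<in>X. adj E y x \<and> dY y \<le> 2 \<and> dX x \<le> 2))"
      using sw.low_structure_max_pair[of y x] q0 False by simp
    then show ?thesis using adj_sym[of E] by metis
  qed
qed

end

section \<open>Transfer from an edge-maximal supergraph to the graph itself\<close>

lemma nbs_mono: "E \<subseteq> F \<Longrightarrow> nbs E S v \<subseteq> nbs F S v"
  by (auto simp: nbs_def adj_def)

lemma low_structure_no_path:
  fixes X Y :: "'a set"
  assumes fin: "finite X" "finite Y" and disj: "X \<inter> Y = {}"
    and cardXY: "card X = m" "card Y = m"
    and uX: "u \<in> X" and vY: "v \<in> Y"
    and minX: "\<And>x. x \<in> X \<Longrightarrow> t \<le> card (nbs E Y x)"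
    and minY: "\<And>y. y \<in> Y \<Longrightarrow> t \<le> card (nbs E X y)"
    and t1: "1 \<le> t"
    and miss: "card {(x, y). x \<in> X \<and> y \<in> Y \<and> \<not> adj E x y} < (t + 1) * (m - t - 2)"
    and no_path: "\<nexists>c. alt_path X Y E u v m c"
  shows "(\<exists>T\<subseteq>X. card T = t \<and> (\<forall>x\<in>T. card (nbs E Y x) \<le> t)) \<or>
    (\<exists>T\<subseteq>Y. card T = t \<and> (\<forall>y\<in>T. card (nbs E X y) \<le> t)) \<or>
    (t = 2 \<and> (\<exists>x\<in>X. \<exists>y\<in>Y. adj E x y \<and> card (nbs E Y x) \<le> 2 \<and> card (nbs E X y) \<le> 2))"
proof -
  define P where "P = (\<lambda>(x, y). {x, y}) ` (X \<times> Y)"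
  define ZS where "ZS = {Z \<in> Pow P. \<nexists>c. alt_path X Y (E \<union> Z) u v m c}"
  have "finite ZS" unfolding ZS_def P_def using fin by simp
  moreover have "{} \<in> ZS" using no_path by (simp add: ZS_def)
  ultimately obtain Z where Z: "Z \<in> ZS" "\<And>Z'. Z' \<in> ZS \<Longrightarrow> Z \<subseteq> Z' \<Longrightarrow> Z = Z'"
    using finite_has_maximal[of ZS] by blast
  define F where "F = E \<union> Z"
  have EF: "E \<subseteq> F" by (simp add: F_def)
  have finF: "finite (nbs F X y)" "finite (nbs F Y x)" for x y using fin by (auto simp: nbs_def)
  have noF: "\<nexists>c. alt_path X Y F u v m c" using Z by (simp add: F_def ZS_def)
  have ex: "\<exists>c. alt_path X Y (insert {x, y} F) u v m c"
    if "x \<in> X" "y \<in> Y" "\<not> adj F x y" for x y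
  proof (rule ccontr)
    assume "\<nexists>c. alt_path X Y (insert {x, y} F) u v m c"
    moreover have "insert {x, y} F = E \<union> insert {x, y} Z" by (auto simp: F_def)
    moreover have "insert {x, y} Z \<subseteq> P" using Z(1) that by (auto simp: ZS_def P_def)
    ultimately have "insert {x, y} Z \<in> ZS" by (simp add: ZS_def)
    then have "{x, y} \<in> Z" using Z(2)[of "insert {x, y} Z"] by blast
    then show False using that by (simp add: F_def adj_def)
  qed
  have dF: "card (nbs E X y) \<le> card (nbs F X y)" "card (nbs E Y x) \<le> card (nbs F Y x)" for x y
    using card_mono[OF finF(1) nbs_mono[OF EF]] card_mono[OF finF(2) nbs_mono[OF EF]] by auto
  note minE = minX
  interpret closed_bigraph X Y F u v m t
  proof
    show "t \<le> card (nbs F Y x)" if "x \<in> X" for x using minX[OF that] dF(2)[of x] by simp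
    show "t \<le> card (nbs F X y)" if "y \<in> Y" for y using minY[OF that] dF(1)[of y] by simp
    have "card {(x, y). x \<in> X \<and> y \<in> Y \<and> \<not> adj F x y} \<le> card {(x, y). x \<in> X \<and> y \<in> Y \<and> \<not> adj E x y}"
    proof (rule card_mono)
      show "finite {(x, y). x \<in> X \<and> y \<in> Y \<and> \<not> adj E x y}"
        by (rule finite_subset[of _ "X \<times> Y"]) (use fin in auto)
    qed (use EF in \<open>auto simp: adj_def\<close>)
    then show "card {(x, y). x \<in> X \<and> y \<in> Y \<and> \<not> adj F x y} < (t + 1) * (m - t - 2)"
      using miss by linarith
    show "\<nexists>c. alt_path X Y F u v m c" by (rule noF)
    fix x y assume xy: "x \<in> X" "y \<in> Y" "\<not> adj F x y"
    show "card (nbs F Y x) + card (nbs F X y) \<le> m + 1"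
      by (rule alt_path_closure(1)[OF fin disj cardXY xy(1,2) noF ex[OF xy]])
    show "adj F x v \<and> adj F u y" if "card (nbs F Y x) + card (nbs F X y) = m + 1"
      by (rule alt_path_closure(2)[OF fin disj cardXY xy(1,2) noF ex[OF xy] that])
  qed (fact fin disj cardXY uX vY t1)+
  consider (1) T where "T \<subseteq> X" "card T = t" "\<forall>x\<in>T. dX x \<le> t"
    | (2) T where "T \<subseteq> Y" "card T = t" "\<forall>y\<in>T. dY y \<le> t"
    | (3) x y where "t = 2" "x \<in> X" "y \<in> Y" "adj F x y" "dX x \<le> 2" "dY y \<le> 2"
    using low_structure_closed by blast
  then show ?thesis
  proof cases
    case 1
    then have "\<forall>x\<in>T. card (nbs E Y x) \<le> t" using dF(2) le_trans by blast
    with 1 show ?thesis by blast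
  next
    case 2
    then have "\<forall>y\<in>T. card (nbs E X y) \<le> t" using dF(1) le_trans by blast
    with 2 show ?thesis by blast
  next
    case 3
    \<comment> \<open>Low degrees pass from F down to the subgraph E, but adjacency does not. It is
      recovered because x has at least t = 2 neighbours in E and at most 2 in F.\<close>
    have "nbs E Y x = nbs F Y x"
      by (rule card_seteq[OF finF(2) nbs_mono[OF EF]]) (use minE[OF 3(2)] 3(1,5) in linarith)
    then have "adj E x y" using 3 by (auto simp: nbs_def)
    then show ?thesis using 3 dF(1)[of y] dF(2)[of x] by (meson le_trans)
  qed
qed

section \<open>The signless Laplacian spectral radius as a maximum\<close>

definition bilin :: "'a set \<Rightarrow> ('a \<Rightarrow> 'a \<Rightarrow> real) \<Rightarrow> ('a \<Rightarrow> real) \<Rightarrow> ('a \<Rightarrow> real) \<Rightarrow> real" where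
  "bilin V A f g = (\<Sum>x\<in>V. \<Sum>y\<in>V. A x y * f x * g y)"

definition inprod :: "'a set \<Rightarrow> ('a \<Rightarrow> real) \<Rightarrow> ('a \<Rightarrow> real) \<Rightarrow> real" where
  "inprod V f g = (\<Sum>x\<in>V. f x * g x)"

lemma inprod_pos:
  assumes "finite V" "x \<in> V" "f x \<noteq> 0"
  shows "inprod V f f > 0"
proof -
  have "0 < f x * f x" using assms(3) by (metis not_real_square_gt_zero)
  also have "\<dots> \<le> inprod V f f"
    unfolding inprod_def using assms by (intro member_le_sum) auto
  finally show ?thesis .
qed

lemma bilin_eq_inprod: "bilin V A f g = inprod V f (\<lambda>x. \<Sum>y\<in>V. A x y * g y)"
  by (simp add: bilin_def inprod_def sum_distrib_left mult_ac)

lemma bilin_eigenvector: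
  assumes "\<forall>x\<in>V. (\<Sum>y\<in>V. A x y * g y) = mu * g x"
  shows "bilin V A f g = mu * inprod V f g"
proof -
  have "bilin V A f g = (\<Sum>x\<in>V. f x * (mu * g x))"
    unfolding bilin_eq_inprod inprod_def using assms by (intro sum.cong) auto
  then show ?thesis by (simp add: inprod_def sum_distrib_left mult_ac)
qed

lemma bilin_sym:
  assumes "\<And>x y. A x y = A y x"
  shows "bilin V A f g = bilin V A g f"
proof -
  have "bilin V A f g = (\<Sum>y\<in>V. \<Sum>x\<in>V. A x y * f x * g y)"
    unfolding bilin_def by (rule sum.swap)
  also have "\<dots> = bilin V A g f"
    unfolding bilin_def by (intro sum.cong refl) (simp add: assms mult_ac)
  finally show ?thesis .
qed

lemma bilin_line:
  assumes "\<And>x y. A x y = A y x"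
  shows "bilin V A (\<lambda>x. f x + e * h x) (\<lambda>x. f x + e * h x) =
    bilin V A f f + 2 * e * bilin V A h f + e\<^sup>2 * bilin V A h h"
proof -
  have "bilin V A (\<lambda>x. f x + e * h x) (\<lambda>x. f x + e * h x) =
    bilin V A f f + e * bilin V A f h + e * bilin V A h f + e\<^sup>2 * bilin V A h h"
    unfolding bilin_def
    by (simp add: algebra_simps sum.distrib sum_distrib_left power2_eq_square)
  then show ?thesis using bilin_sym[where A = A, OF assms, of V f h] by (simp add: algebra_simps)
qed

lemma inprod_line:
  "inprod V (\<lambda>x. f x + e * h x) (\<lambda>x. f x + e * h x) =
    inprod V f f + 2 * e * inprod V h f + e\<^sup>2 * inprod V h h"
  unfolding inprod_def
  by (simp add: algebra_simps sum.distrib sum_distrib_left power2_eq_square)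

lemma inprod_scale: "inprod V (\<lambda>x. c * f x) (\<lambda>x. c * f x) = c\<^sup>2 * inprod V f f"
  by (simp add: inprod_def sum_distrib_left power2_eq_square mult_ac)

lemma bilin_scale: "bilin V A (\<lambda>x. c * f x) (\<lambda>x. c * f x) = c\<^sup>2 * bilin V A f f"
  by (simp add: bilin_def sum_distrib_left power2_eq_square mult_ac)

lemma linear_coeff_zero:
  fixes c d :: real
  assumes "\<And>e. 2 * e * c + e\<^sup>2 * d \<le> 0"
  shows "c = 0"
proof (rule ccontr)
  assume c: "c \<noteq> 0"
  \<comment> \<open>The step is small enough that the quadratic term costs at most e*c, half of the
    linear gain 2*e*c, leaving a positive value.\<close>
  define e where "e = c / (\<bar>d\<bar> + 1)"
  have "e\<^sup>2 * \<bar>d\<bar> \<le> e\<^sup>2 * (\<bar>d\<bar> + 1)" by (simp add: mult_left_mono)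
  also have "\<dots> = e * (e * (\<bar>d\<bar> + 1))" by (simp add: power2_eq_square)
  also have "e * (\<bar>d\<bar> + 1) = c" by (simp add: e_def add_nonneg_eq_0_iff)
  finally have "e\<^sup>2 * \<bar>d\<bar> \<le> e * c" .
  moreover have "e\<^sup>2 * d \<ge> - (e\<^sup>2 * \<bar>d\<bar>)"
    by (metis abs_ge_minus_self abs_mult abs_power2 minus_le_iff)
  moreover have "e * c > 0"
  proof -
    have "e * c = c\<^sup>2 / (\<bar>d\<bar> + 1)" by (simp add: e_def power2_eq_square)
    moreover have "c\<^sup>2 > 0" "\<bar>d\<bar> + 1 > 0" using c by auto
    ultimately show ?thesis by simp
  qed
  ultimately show False using assms[of e] by linarith
qed

text \<open>The form \<open>l * inprod V g g - bilin V A g g\<close> is nonnegative and vanishes at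
  f, so its derivative at f vanishes in each coordinate direction. This is the eigenvalue equation
  at x.\<close>

lemma maximal_vector_eigenvector:
  assumes fin: "finite V" and sym: "\<And>x y. A x y = A y x"
    and bound: "\<And>g. bilin V A g g \<le> l * inprod V g g"
    and eq: "bilin V A f f = l * inprod V f f" and x: "x \<in> V"
  shows "(\<Sum>y\<in>V. A x y * f y) = l * f x"
proof -
  define h :: "'a \<Rightarrow> real" where "h y = (if y = x then 1 else 0)" for y
  have "bilin V A h f - l * inprod V h f = 0"
  proof (rule linear_coeff_zero[where d = "bilin V A h h - l * inprod V h h"])
    fix e
    show "2 * e * (bilin V A h f - l * inprod V h f) + e\<^sup>2 * (bilin V A h h - l * inprod V h h) \<le> 0"
      using bound[of "\<lambda>x. f x + e * h x"] eq
      unfolding bilin_line[where A = A, OF sym] inprod_line by (simp add: algebra_simps)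
  qed
  moreover have "inprod V h g = g x" for g
    using fin x by (simp add: inprod_def h_def if_distrib[of "\<lambda>a. a * _"] sum.delta' cong: if_cong)
  ultimately show ?thesis by (simp add: bilin_eq_inprod)
qed

lemma ex_maximal_vector:
  fixes A :: "'a \<Rightarrow> 'a \<Rightarrow> real"
  assumes fin: "finite V" and ne: "V \<noteq> {}"
  shows "\<exists>f. inprod V f f = 1 \<and> (\<forall>g. bilin V A g g \<le> bilin V A f f * inprod V g g)"
proof -
  \<comment> \<open>Values off V do not affect the forms, so the unit sphere is not compact in the
    function space. Pinning them to 0 and bounding the others by 1 gives a compact product that
    meets every normalised direction.\<close>
  define K :: "('a \<Rightarrow> real) set" where "K = PiE UNIV (\<lambda>x. if x \<in> V then {-1..1} else {0})"
  define S where "S = K \<inter> {f. inprod V f f = 1}"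
  have "compact K"
    unfolding K_def compactin_euclidean_iff[symmetric] euclidean_product_topology[symmetric]
    by (subst compactin_PiE) auto
  have coord: "continuous_on T (\<lambda>f :: 'a \<Rightarrow> real. f x)" for T x
    by (rule continuous_on_subset[OF continuous_on_product_coordinates]) simp
  have "continuous_on UNIV (\<lambda>f. inprod V f f)"
    unfolding inprod_def by (intro continuous_intros coord)
  then have "closed {f. inprod V f f = 1}"
    by (intro closed_Collect_eq continuous_on_const)
  with \<open>compact K\<close> have "compact S" unfolding S_def by (rule compact_Int_closed)
  obtain x0 where x0: "x0 \<in> V" using ne by blast
  have "(\<lambda>x. if x = x0 then 1 else 0) \<in> S"
    using fin x0 by (auto simp: S_def K_def inprod_def sum.delta' if_distrib[of "\<lambda>a. a * _"] cong: if_cong)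
  then have "S \<noteq> {}" by blast
  have "continuous_on S (\<lambda>f. bilin V A f f)"
    unfolding bilin_def by (intro continuous_intros coord)
  from continuous_attains_sup[OF \<open>compact S\<close> \<open>S \<noteq> {}\<close> this]
  obtain f where f: "f \<in> S" "\<And>g. g \<in> S \<Longrightarrow> bilin V A g g \<le> bilin V A f f" by blast
  have "bilin V A g g \<le> bilin V A f f * inprod V g g" for g
  proof (cases "\<exists>x\<in>V. g x \<noteq> 0")
    case True
    then have pos: "inprod V g g > 0" using inprod_pos[OF fin] by blast
    define c where "c = 1 / sqrt (inprod V g g)"
    define g' where "g' x = (if x \<in> V then c * g x else 0)" for x
    have c2: "c\<^sup>2 = 1 / inprod V g g" using pos by (simp add: c_def power_divide)
    have n: "inprod V g' g' = c\<^sup>2 * inprod V g g"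
      unfolding inprod_scale[symmetric] by (simp add: inprod_def g'_def cong: sum.cong)
    have b: "bilin V A g' g' = c\<^sup>2 * bilin V A g g"
      unfolding bilin_scale[symmetric] by (simp add: bilin_def g'_def cong: sum.cong)
    have n1: "inprod V g' g' = 1" using n c2 pos by simp
    have "\<bar>g' x\<bar> \<le> 1" if "x \<in> V" for x
    proof -
      have "g' x * g' x \<le> inprod V g' g'"
        unfolding inprod_def using fin that by (intro member_le_sum) auto
      then have "(g' x)\<^sup>2 \<le> 1" using n1 by (simp add: power2_eq_square)
      then show ?thesis by (simp add: abs_square_le_1)
    qed
    then have "g' \<in> K" by (auto simp: K_def g'_def abs_le_iff split: if_splits)
    then have "g' \<in> S" using n1 by (simp add: S_def)
    from f(2)[OF this] b c2 pos show ?thesis by (simp add: field_simps)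
  next
    case False
    then show ?thesis by (simp add: bilin_def inprod_def)
  qed
  moreover have "inprod V f f = 1" using f(1) by (simp add: S_def)
  ultimately show ?thesis by blast
qed

section \<open>Finiteness of the spectrum and the Rayleigh quotient\<close>

text \<open>The squared norms add up to card S. Summed coordinate by coordinate instead, the same
  total is at most card V, since Bessel's inequality bounds each coordinate by 1.\<close>

lemma orthonormal_card_le:
  fixes w :: "'b \<Rightarrow> 'a \<Rightarrow> real"
  assumes fin: "finite V" "finite S"
    and norm: "\<And>i. i \<in> S \<Longrightarrow> inprod V (w i) (w i) = 1"
    and orth: "\<And>i j. i \<in> S \<Longrightarrow> j \<in> S \<Longrightarrow> i \<noteq> j \<Longrightarrow> inprod V (w i) (w j) = 0"
  shows "card S \<le> card V"
proof -
  text \<open>Bessel's inequality for the unit vector at x.\<close>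
  have bessel: "(\<Sum>i\<in>S. (w i x)\<^sup>2) \<le> 1" if x: "x \<in> V" for x
  proof -
    define e :: "'a \<Rightarrow> real" where "e y = (if y = x then 1 else 0)" for y
    have ee: "(\<Sum>y\<in>V. e y * g y) = g x" for g
      using fin x by (simp add: e_def if_distrib[of "\<lambda>a. a * _"] sum.delta' cong: if_cong)
    have "(\<Sum>y\<in>V. (\<Sum>i\<in>S. w i x * w i y) * (\<Sum>j\<in>S. w j x * w j y)) =
        (\<Sum>y\<in>V. \<Sum>i\<in>S. \<Sum>j\<in>S. w i x * w j x * (w i y * w j y))"
      by (simp add: sum_product mult_ac)
    also have "\<dots> = (\<Sum>i\<in>S. \<Sum>j\<in>S. \<Sum>y\<in>V. w i x * w j x * (w i y * w j y))"
      by (subst sum.swap, intro sum.cong refl, rule sum.swap)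
    also have "\<dots> = (\<Sum>i\<in>S. \<Sum>j\<in>S. w i x * w j x * inprod V (w i) (w j))"
      by (simp add: inprod_def sum_distrib_left)
    also have "\<dots> = (\<Sum>i\<in>S. \<Sum>j\<in>S. if j = i then (w i x)\<^sup>2 else 0)"
      by (intro sum.cong refl) (auto simp: norm orth power2_eq_square)
    also have "\<dots> = (\<Sum>i\<in>S. (w i x)\<^sup>2)"
      using fin by (simp add: sum.delta')
    finally have sq: "(\<Sum>y\<in>V. (\<Sum>i\<in>S. w i x * w i y) * (\<Sum>j\<in>S. w j x * w j y)) = (\<Sum>i\<in>S. (w i x)\<^sup>2)" .
    have "0 \<le> (\<Sum>y\<in>V. (e y - (\<Sum>i\<in>S. w i x * w i y))\<^sup>2)"
      by (intro sum_nonneg) auto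
    also have "\<dots> = (\<Sum>y\<in>V. e y * e y) - 2 * (\<Sum>y\<in>V. e y * (\<Sum>i\<in>S. w i x * w i y)) +
        (\<Sum>y\<in>V. (\<Sum>i\<in>S. w i x * w i y) * (\<Sum>j\<in>S. w j x * w j y))"
      by (simp add: power2_eq_square algebra_simps sum.distrib sum_subtractf sum_distrib_left)
    also have "\<dots> = 1 - (\<Sum>i\<in>S. (w i x)\<^sup>2)"
      unfolding sq ee by (simp add: e_def power2_eq_square)
    finally show ?thesis by simp
  qed
  have "real (card S) = (\<Sum>i\<in>S. \<Sum>x\<in>V. (w i x)\<^sup>2)"
    using norm by (simp add: inprod_def power2_eq_square)
  also have "\<dots> = (\<Sum>x\<in>V. \<Sum>i\<in>S. (w i x)\<^sup>2)" by (rule sum.swap)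
  also have "\<dots> \<le> (\<Sum>x\<in>V. 1)" by (intro sum_mono bessel)
  finally show ?thesis by simp
qed

lemma signless_laplacian_sym: "signless_laplacian V E x y = signless_laplacian V E y x"
  by (simp add: signless_laplacian_def adj_def insert_commute)

text \<open>\<open>q_radius\<close> is a \<open>Max\<close>, which carries its meaning only on a
  finite set. Unit eigenvectors for distinct eigenvalues are orthogonal by symmetry, so every finite
  set of eigenvalues has at most card V elements.\<close>

lemma finite_Q_eigenvalues:
  assumes fin: "finite V"
  shows "finite (Q_eigenvalues V E)"
proof -
  let ?Q = "signless_laplacian V E"
  have "\<exists>v. inprod V v v = 1 \<and> (\<forall>x\<in>V. (\<Sum>y\<in>V. ?Q x y * v y) = mu * v x)"
    if mu: "mu \<in> Q_eigenvalues V E" for mu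
  proof -
    obtain v where v: "\<exists>x\<in>V. v x \<noteq> 0" "\<forall>x\<in>V. (\<Sum>y\<in>V. ?Q x y * v y) = mu * v x"
      using mu unfolding Q_eigenvalues_def by blast
    then have pos: "inprod V v v > 0" using inprod_pos[OF fin] by blast
    define c where "c = 1 / sqrt (inprod V v v)"
    have "inprod V (\<lambda>x. c * v x) (\<lambda>x. c * v x) = 1"
      unfolding inprod_scale using pos by (simp add: c_def power_divide)
    moreover have "(\<Sum>y\<in>V. ?Q x y * (c * v y)) = mu * (c * v x)" if "x \<in> V" for x
    proof -
      have "(\<Sum>y\<in>V. ?Q x y * (c * v y)) = c * (\<Sum>y\<in>V. ?Q x y * v y)"
        by (simp add: sum_distrib_left mult_ac)
      then show ?thesis using v(2) that by simp
    qed
    ultimately show ?thesis by blast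
  qed
  then obtain w where w: "\<And>mu. mu \<in> Q_eigenvalues V E \<Longrightarrow> inprod V (w mu) (w mu) = 1"
    "\<And>mu. mu \<in> Q_eigenvalues V E \<Longrightarrow> \<forall>x\<in>V. (\<Sum>y\<in>V. ?Q x y * w mu y) = mu * w mu x"
    by metis
  have orth: "inprod V (w a) (w b) = 0"
    if "a \<in> Q_eigenvalues V E" "b \<in> Q_eigenvalues V E" "a \<noteq> b" for a b
  proof -
    have "b * inprod V (w a) (w b) = bilin V ?Q (w a) (w b)"
      using bilin_eigenvector[OF w(2)[OF that(2)]] by simp
    also have "\<dots> = bilin V ?Q (w b) (w a)" by (rule bilin_sym[OF signless_laplacian_sym])
    also have "\<dots> = a * inprod V (w b) (w a)"
      using bilin_eigenvector[OF w(2)[OF that(1)]] by simp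
    also have "inprod V (w b) (w a) = inprod V (w a) (w b)" by (simp add: inprod_def mult.commute)
    finally show ?thesis using that(3) by simp
  qed
  have "card G \<le> card V" if "G \<subseteq> Q_eigenvalues V E" "finite G" for G
  proof (rule orthonormal_card_le[OF fin that(2), of w])
    show "inprod V (w i) (w i) = 1" if "i \<in> G" for i
      by (rule w(1)) (use that \<open>G \<subseteq> _\<close> in blast)
    show "inprod V (w i) (w j) = 0" if "i \<in> G" "j \<in> G" "i \<noteq> j" for i j
      by (rule orth) (use that \<open>G \<subseteq> _\<close> in blast)+
  qed
  then show ?thesis using finite_if_finite_subsets_card_bdd[of "Q_eigenvalues V E" "card V"] by blast
qed

text \<open>The maximum of the Rayleigh quotient is an eigenvalue by
  \<open>maximal_vector_eigenvector\<close>, and no eigenvalue exceeds it. As the matrix has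
  nonnegative entries, passing to absolute values cannot lower the quotient, so a nonnegative
  maximiser exists.\<close>

lemma q_radius_maximal_vector:
  assumes fin: "finite V" and ne: "V \<noteq> {}"
  shows "bilin V (signless_laplacian V E) g g \<le> q_radius V E * inprod V g g"
    and "\<exists>f. (\<forall>x. f x \<ge> 0) \<and> (\<exists>x\<in>V. f x \<noteq> 0) \<and>
      bilin V (signless_laplacian V E) f f = q_radius V E * inprod V f f"
    and "q_radius V E \<in> Q_eigenvalues V E"
proof -
  let ?Q = "signless_laplacian V E"
  obtain f where f: "inprod V f f = 1" "\<And>g. bilin V ?Q g g \<le> bilin V ?Q f f * inprod V g g"
    using ex_maximal_vector[OF fin ne, of ?Q] by blast
  define l where "l = bilin V ?Q f f"
  have fl: "bilin V ?Q g g \<le> l * inprod V g g" for g using f(2) by (simp add: l_def)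
  have nz: "\<exists>x\<in>V. f x \<noteq> 0"
  proof (rule ccontr)
    assume "\<not> ?thesis"
    then have "inprod V f f = 0" by (simp add: inprod_def)
    with f(1) show False by simp
  qed
  have l_in: "l \<in> Q_eigenvalues V E"
    unfolding Q_eigenvalues_def
    using nz maximal_vector_eigenvector[where A = ?Q, OF fin signless_laplacian_sym fl, of f] f(1) l_def
    by auto
  have l_max: "mu \<le> l" if mu: "mu \<in> Q_eigenvalues V E" for mu
  proof -
    obtain v where v: "\<exists>x\<in>V. v x \<noteq> 0" "\<forall>x\<in>V. (\<Sum>y\<in>V. ?Q x y * v y) = mu * v x"
      using mu unfolding Q_eigenvalues_def by blast
    then have pos: "inprod V v v > 0" using inprod_pos[OF fin] by blast
    have "mu * inprod V v v \<le> l * inprod V v v"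
      using fl[of v] bilin_eigenvector[OF v(2), of v] by simp
    then show ?thesis using pos by simp
  qed
  have q: "q_radius V E = l"
    unfolding q_radius_def using finite_Q_eigenvalues[OF fin] l_in l_max by (intro Max_eqI) auto
  show b: "bilin V ?Q g g \<le> q_radius V E * inprod V g g" for g
    using fl q by simp
  show "q_radius V E \<in> Q_eigenvalues V E" using l_in q by simp
  let ?g = "\<lambda>x. \<bar>f x\<bar>"
  have "?Q x y * f x * f y \<le> ?Q x y * ?g x * ?g y" for x y
  proof -
    have "?Q x y \<ge> 0" by (simp add: signless_laplacian_def)
    then have "?Q x y * (f x * f y) \<le> ?Q x y * (?g x * ?g y)"
      by (intro mult_left_mono) (simp_all flip: abs_mult)
    then show ?thesis by (simp add: mult.assoc)
  qed
  then have "bilin V ?Q f f \<le> bilin V ?Q ?g ?g"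
    unfolding bilin_def by (intro sum_mono)
  moreover have "inprod V ?g ?g = inprod V f f" by (simp add: inprod_def)
  ultimately have "bilin V ?Q ?g ?g = q_radius V E * inprod V ?g ?g"
    using b[of ?g] f(1) q l_def by simp
  then show "\<exists>f. (\<forall>x. f x \<ge> 0) \<and> (\<exists>x\<in>V. f x \<noteq> 0) \<and> bilin V ?Q f f = q_radius V E * inprod V f f"
    using nz by (intro exI[of _ ?g]) auto
qed

text \<open>The Collatz--Wielandt bound: compare an eigenvector with w at a vertex maximising the ratio.\<close>

lemma q_radius_le:
  assumes fin: "finite V" and ne: "V \<noteq> {}"
    and w: "\<And>x. x \<in> V \<Longrightarrow> w x > 0"
    and le: "\<And>x. x \<in> V \<Longrightarrow> (\<Sum>y\<in>V. signless_laplacian V E x y * w y) \<le> l * w x"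
  shows "q_radius V E \<le> l"
proof -
  let ?Q = "signless_laplacian V E"
  obtain v where v: "\<exists>x\<in>V. v x \<noteq> 0" "\<forall>x\<in>V. (\<Sum>y\<in>V. ?Q x y * v y) = q_radius V E * v x"
    using q_radius_maximal_vector(3)[OF fin ne, of E] unfolding Q_eigenvalues_def by blast
  let ?r = "\<lambda>x. \<bar>v x\<bar> / w x"
  have "Max (?r ` V) \<in> ?r ` V" using fin ne by (intro Max_in) auto
  then obtain z where z: "z \<in> V" "?r z = Max (?r ` V)" by force
  have mx: "\<bar>v y\<bar> \<le> ?r z * w y" if "y \<in> V" for y
  proof -
    have "?r y \<le> ?r z" unfolding z(2) using fin that by simp
    then show ?thesis using w[OF that] by (simp add: pos_divide_le_eq)
  qed
  obtain y where y: "y \<in> V" "v y \<noteq> 0" using v(1) by blast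
  have "0 < ?r z * w y" using mx[OF y(1)] y(2) by linarith
  then have rz: "?r z > 0" using w[OF y(1)] zero_less_mult_pos2 by blast
  have "q_radius V E * \<bar>v z\<bar> \<le> \<bar>q_radius V E * v z\<bar>" by (simp add: abs_mult mult_right_mono)
  also have "\<dots> = \<bar>\<Sum>y\<in>V. ?Q z y * v y\<bar>" using v(2) z(1) by simp
  also have "\<dots> \<le> (\<Sum>y\<in>V. \<bar>?Q z y * v y\<bar>)" by (rule sum_abs)
  also have "\<dots> \<le> (\<Sum>y\<in>V. ?r z * (?Q z y * w y))"
  proof (rule sum_mono)
    fix y assume "y \<in> V"
    have "?Q z y \<ge> 0" by (simp add: signless_laplacian_def)
    then have "\<bar>?Q z y * v y\<bar> = ?Q z y * \<bar>v y\<bar>" by (simp add: abs_mult)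
    also have "\<dots> \<le> ?Q z y * (?r z * w y)" using mx[OF \<open>y \<in> V\<close>] \<open>?Q z y \<ge> 0\<close> by (rule mult_left_mono)
    finally show "\<bar>?Q z y * v y\<bar> \<le> ?r z * (?Q z y * w y)" by (simp add: mult_ac)
  qed
  also have "\<dots> = ?r z * (\<Sum>y\<in>V. ?Q z y * w y)" by (simp add: sum_distrib_left)
  also have "\<dots> \<le> ?r z * (l * w z)" using le[OF z(1)] rz by (intro mult_left_mono) auto
  also have "\<dots> = l * \<bar>v z\<bar>" using w[OF z(1)] by simp
  finally show ?thesis using rz w[OF z(1)] by (simp add: zero_less_divide_iff)
qed

section \<open>Bipartite graphs and the extremal graph\<close>

lemma bipartite_edgeD:
  assumes "bipartite_graph X Y E" "e \<in> E"
  obtains x y where "e = {x, y}" "x \<in> X" "y \<in> Y"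
  using assms unfolding bipartite_graph_def by blast

lemma bipartite_swap:
  assumes "bipartite_graph X Y E"
  shows "bipartite_graph Y X E"
proof -
  have "\<exists>y x. e = {y, x} \<and> y \<in> Y \<and> x \<in> X" if "e \<in> E" for e
    using bipartite_edgeD[OF assms that] by (metis insert_commute)
  then show ?thesis using assms unfolding bipartite_graph_def by blast
qed

lemma bipartite_no_adj:
  assumes "bipartite_graph X Y E"
  shows "x \<in> X \<Longrightarrow> x' \<in> X \<Longrightarrow> \<not> adj E x x'" "y \<in> Y \<Longrightarrow> y' \<in> Y \<Longrightarrow> \<not> adj E y y'"
proof -
  have disj: "X \<inter> Y = {}" using assms by (simp add: bipartite_graph_def)
  have *: "a \<in> X \<and> b \<in> Y \<or> a \<in> Y \<and> b \<in> X" if "adj E a b" for a b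
    using that unfolding adj_def by (rule bipartite_edgeD[OF assms]) (auto simp: doubleton_eq_iff)
  show "x \<in> X \<Longrightarrow> x' \<in> X \<Longrightarrow> \<not> adj E x x'" using *[of x x'] disj by blast
  show "y \<in> Y \<Longrightarrow> y' \<in> Y \<Longrightarrow> \<not> adj E y y'" using *[of y y'] disj by blast
qed

lemma bipartite_degree:
  assumes "bipartite_graph X Y E" "x \<in> X"
  shows "degree (X \<union> Y) E x = card (nbs E Y x)"
proof -
  have "{y \<in> X \<union> Y. adj E x y} = nbs E Y x"
    using bipartite_no_adj(1)[OF assms] by (auto simp: nbs_def)
  then show ?thesis by (simp add: degree_def)
qed

lemma bipartite_row:
  assumes b: "bipartite_graph X Y E" and x: "x \<in> X"
  shows "(\<Sum>y\<in>X \<union> Y. signless_laplacian (X \<union> Y) E x y * g y) = (\<Sum>y\<in>nbs E Y x. g x + g y)"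
proof -
  have fin: "finite X" "finite Y" using b by (auto simp: bipartite_graph_def)
  have "(\<Sum>y\<in>X \<union> Y. signless_laplacian (X \<union> Y) E x y * g y) =
      (\<Sum>y\<in>X \<union> Y. if y = x then real (degree (X \<union> Y) E x) * g y else 0) +
      (\<Sum>y\<in>X \<union> Y. if adj E x y then g y else 0)"
    unfolding sum.distrib[symmetric] by (intro sum.cong) (auto simp: signless_laplacian_def algebra_simps)
  also have "(\<Sum>y\<in>X \<union> Y. if y = x then real (degree (X \<union> Y) E x) * g y else 0) = card (nbs E Y x) * g x"
    using fin x bipartite_degree[OF b x] by (simp add: sum.delta)
  also have "(\<Sum>y\<in>X \<union> Y. if adj E x y then g y else 0) = (\<Sum>y\<in>nbs E Y x. g y)"
    using fin bipartite_no_adj(1)[OF b x]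
    by (intro sum.mono_neutral_cong_right) (auto simp: nbs_def)
  finally show ?thesis by (simp add: sum.distrib)
qed

lemma bipartite_row':
  assumes b: "bipartite_graph X Y E" and y: "y \<in> Y"
  shows "(\<Sum>x\<in>X \<union> Y. signless_laplacian (X \<union> Y) E y x * g x) = (\<Sum>x\<in>nbs E X y. g y + g x)"
  using bipartite_row[OF bipartite_swap[OF b] y, of g] by (simp add: Un_commute)

text \<open>Each edge contributes the square of the sum of its end values. Grouping the edges at
  their ends in Y lets neighbourhoods be compared one vertex at a time.\<close>

lemma bipartite_form:
  assumes b: "bipartite_graph X Y E"
  shows "bilin (X \<union> Y) (signless_laplacian (X \<union> Y) E) g g = (\<Sum>y\<in>Y. \<Sum>x\<in>nbs E X y. (g x + g y)\<^sup>2)"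
proof -
  have fin: "finite X" "finite Y" and disj: "X \<inter> Y = {}" using b by (auto simp: bipartite_graph_def)
  have nb: "(\<Sum>y\<in>nbs E S x. h y) = (\<Sum>y\<in>S. if adj E x y then h y else 0)"
    if "finite S" for S x and h :: "'a \<Rightarrow> real"
    using that by (simp add: nbs_def sum.inter_filter)
  have "bilin (X \<union> Y) (signless_laplacian (X \<union> Y) E) g g =
      (\<Sum>x\<in>X. g x * (\<Sum>y\<in>nbs E Y x. g x + g y)) + (\<Sum>y\<in>Y. g y * (\<Sum>x\<in>nbs E X y. g y + g x))"
    unfolding bilin_eq_inprod inprod_def sum.union_disjoint[OF fin disj]
    using bipartite_row[OF b, of _ g] bipartite_row'[OF b, of _ g]
    by (intro arg_cong2[of _ _ _ _ "(+)"] sum.cong) (auto simp: sum.union_disjoint[OF fin disj])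
  also have "(\<Sum>x\<in>X. g x * (\<Sum>y\<in>nbs E Y x. g x + g y)) =
      (\<Sum>x\<in>X. \<Sum>y\<in>Y. if adj E x y then g x * (g x + g y) else 0)"
    unfolding nb[OF fin(2)] sum_distrib_left by (intro sum.cong) auto
  also have "\<dots> = (\<Sum>y\<in>Y. \<Sum>x\<in>X. if adj E y x then g x * (g x + g y) else 0)"
    by (subst sum.swap) (simp add: adj_sym)
  also have "\<dots> = (\<Sum>y\<in>Y. \<Sum>x\<in>nbs E X y. g x * (g x + g y))"
    unfolding nb[OF fin(1)] ..
  finally show ?thesis
    unfolding sum_distrib_left sum.distrib[symmetric]
    by (simp add: power2_eq_square algebra_simps)
qed

section \<open>Bounding the radius by the number of edges\<close>

text \<open>Here d is a degree and S the sum of the degrees of the neighbours. If d is at most e/n,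
  the bound S \<le> nd suffices. Otherwise S \<le> e is used: d lies between e/n and n, the roots of
  d*d - (n + e/n)d + e.\<close>

lemma row_degree_bound:
  fixes d S n e :: real
  assumes "0 \<le> d" "d \<le> n" "0 < n" "S \<le> e" "S \<le> n * d"
  shows "d * d + S \<le> (n + e / n) * d"
proof (cases "n * d \<le> e")
  case True
  then have "d \<le> e / n" using assms by (simp add: field_simps)
  then have "d * d \<le> e / n * d" using assms by (intro mult_right_mono)
  then show ?thesis using assms by (simp add: algebra_simps)
next
  case False
  then have "e / n \<le> d" using assms by (simp add: field_simps)
  then have "0 \<le> (n - d) * (d - e / n)" using assms by simp
  also have "\<dots> = (n + e / n) * d - d * d - e" using assms by (simp add: field_simps)
  finally show ?thesis using assms by simp
qed

lemma q_radius_le_edges: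
  assumes b: "bipartite_graph X Y E" and card: "card X = n" "card Y = n" and n: "n > 0"
    and pos: "\<And>x. x \<in> X \<Longrightarrow> card (nbs E Y x) > 0" "\<And>y. y \<in> Y \<Longrightarrow> card (nbs E X y) > 0"
  shows "q_radius (X \<union> Y) E \<le> n + real (card {(x, y). x \<in> X \<and> y \<in> Y \<and> adj E x y}) / n"
proof -
  have fin: "finite X" "finite Y" and disj: "X \<inter> Y = {}" using b by (auto simp: bipartite_graph_def)
  define e where "e = card {(x, y). x \<in> X \<and> y \<in> Y \<and> adj E x y}"
  define w where "w v = real (if v \<in> X then card (nbs E Y v) else card (nbs E X v))" for v
  have "{(x, y). x \<in> X \<and> y \<in> Y \<and> adj E x y} = (SIGMA x:X. nbs E Y x)"
    by (auto simp: nbs_def)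
  then have e1: "e = (\<Sum>x\<in>X. card (nbs E Y x))"
    using fin by (simp add: e_def card_SigmaI nbs_def)
  have "bij_betw prod.swap {(x, y). x \<in> X \<and> y \<in> Y \<and> adj E x y} (SIGMA y:Y. nbs E X y)"
    by (rule bij_betwI[where g = prod.swap]) (auto simp: nbs_def adj_sym)
  from bij_betw_same_card[OF this] have e2: "e = (\<Sum>y\<in>Y. card (nbs E X y))"
    using fin by (simp add: e_def card_SigmaI nbs_def)
  have row: "(\<Sum>y\<in>nbs E B x. w x + w y) \<le> (real n + real e / real n) * w x"
    if wx: "w x = card (nbs E B x)" and wB: "\<And>y. y \<in> B \<Longrightarrow> w y = card (nbs E A y)"
      and AB: "finite A" "finite B" "card A = n" "card B = n" and e: "e = (\<Sum>y\<in>B. card (nbs E A y))"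
    for x A B
  proof -
    have sub: "nbs E B x \<subseteq> B" "\<And>y. nbs E A y \<subseteq> A" by (auto simp: nbs_def)
    have le: "card (nbs E B x) \<le> n" "\<And>y. card (nbs E A y) \<le> n"
      using card_mono[OF AB(2) sub(1)] card_mono[OF AB(1) sub(2)] AB by auto
    have S: "(\<Sum>y\<in>nbs E B x. w y) = (\<Sum>y\<in>nbs E B x. real (card (nbs E A y)))"
      using wB sub by (intro sum.cong) auto
    \<comment> \<open>All neighbours lie in one class, so their degrees count each edge at most
      once.\<close>
    have "(\<Sum>y\<in>nbs E B x. real (card (nbs E A y))) \<le> e"
      unfolding e of_nat_sum using AB sub by (intro sum_mono2) auto
    moreover have "(\<Sum>y\<in>nbs E B x. real (card (nbs E A y))) \<le> n * w x"
      using sum_mono[of "nbs E B x" "\<lambda>y. real (card (nbs E A y))" "\<lambda>_. real n"] le wx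
      by (simp add: mult.commute)
    ultimately have "w x * w x + (\<Sum>y\<in>nbs E B x. w y) \<le> (n + e / n) * w x"
      unfolding S using n le wx by (intro row_degree_bound) auto
    then show ?thesis by (simp add: sum.distrib wx)
  qed
  show ?thesis
    unfolding e_def[symmetric]
  proof (rule q_radius_le[where w = w])
    show "finite (X \<union> Y)" using fin by simp
    show "X \<union> Y \<noteq> {}" using card n by auto
    show "w x > 0" if "x \<in> X \<union> Y" for x using that pos by (auto simp: w_def)
    have wX: "w x = card (nbs E Y x)" if "x \<in> X" for x using that by (simp add: w_def)
    have wY: "w y = card (nbs E X y)" if "y \<in> Y" for y using that disj by (auto simp: w_def)
    show "(\<Sum>y\<in>X \<union> Y. signless_laplacian (X \<union> Y) E x y * w y) \<le> (n + e / n) * w x"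
      if x: "x \<in> X \<union> Y" for x
    proof (cases "x \<in> X")
      case True
      show ?thesis unfolding bipartite_row[OF b True]
        by (rule row[OF wX[OF True] wY fin card e2])
    next
      case False
      then have "x \<in> Y" using x by simp
      show ?thesis unfolding bipartite_row'[OF b \<open>x \<in> Y\<close>]
        by (rule row[OF wY[OF \<open>x \<in> Y\<close>] wX fin(2,1) card(2,1) e1])
    qed
  qed
qed

section \<open>Concrete copies of the extremal graph\<close>

text \<open>The graph M on given vertex classes, with \<open>X2\<close> for $X_2$ and \<open>T\<close> for $Y_2$.\<close>

definition join_edges :: "'a set \<Rightarrow> 'a set \<Rightarrow> 'a set \<Rightarrow> 'a set \<Rightarrow> 'a set set" where
  "join_edges X Y X2 T = {{x, y} | x y. x \<in> X \<and> y \<in> Y \<and> (x \<in> X2 \<or> y \<notin> T)}"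

lemma join_edges_adj:
  assumes "X \<inter> Y = {}" "x \<in> X" "y \<in> Y"
  shows "adj (join_edges X Y X2 T) x y \<longleftrightarrow> x \<in> X2 \<or> y \<notin> T"
  using assms unfolding adj_def join_edges_def by (auto simp: doubleton_eq_iff)

lemma join_edges_bipartite:
  assumes "finite X" "finite Y" "X \<inter> Y = {}"
  shows "bipartite_graph X Y (join_edges X Y X2 T)"
  using assms unfolding bipartite_graph_def join_edges_def by blast

lemma join_edges_nbs:
  assumes "X \<inter> Y = {}" "X2 \<subseteq> X" "T \<subseteq> Y"
  shows "x \<in> X \<Longrightarrow> nbs (join_edges X Y X2 T) Y x = (if x \<in> X2 then Y else Y - T)"
    "y \<in> Y \<Longrightarrow> nbs (join_edges X Y X2 T) X y = (if y \<in> T then X2 else X)"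
  using assms join_edges_adj[OF assms(1), of _ _ X2 T]
    adj_sym[of "join_edges X Y X2 T" y]
  by (auto simp: nbs_def)

lemma graph_iso_eigenvalues:
  assumes f: "bij_betw f V V'" and adj: "\<forall>x\<in>V. \<forall>y\<in>V. adj E x y \<longleftrightarrow> adj E' (f x) (f y)"
  shows "Q_eigenvalues V' E' \<subseteq> Q_eigenvalues V E"
proof
  fix mu assume "mu \<in> Q_eigenvalues V' E'"
  then obtain v where v: "\<exists>x\<in>V'. v x \<noteq> 0"
    "\<forall>x\<in>V'. (\<Sum>y\<in>V'. signless_laplacian V' E' x y * v y) = mu * v x"
    unfolding Q_eigenvalues_def by blast
  have inj: "inj_on f V" and im: "f ` V = V'" using f by (auto simp: bij_betw_def)
  have deg: "degree V' E' (f x) = degree V E x" if "x \<in> V" for x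
  proof -
    have "{y \<in> V'. adj E' (f x) y} = f ` {y \<in> V. adj E x y}" using im adj that by auto
    moreover have "inj_on f {y \<in> V. adj E x y}" using inj by (rule inj_on_subset) auto
    ultimately show ?thesis by (simp add: degree_def card_image)
  qed
  have Q: "signless_laplacian V' E' (f x) (f y) = signless_laplacian V E x y" if "x \<in> V" "y \<in> V" for x y
    using that deg adj inj by (auto simp: signless_laplacian_def inj_on_eq_iff)
  have "(\<Sum>y\<in>V. signless_laplacian V E x y * v (f y)) = mu * v (f x)" if "x \<in> V" for x
  proof -
    have "(\<Sum>y\<in>V. signless_laplacian V E x y * v (f y)) =
        (\<Sum>y\<in>V. signless_laplacian V' E' (f x) (f y) * v (f y))"
      using Q that by (intro sum.cong) auto
    also have "\<dots> = (\<Sum>y\<in>V'. signless_laplacian V' E' (f x) y * v y)"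
      unfolding im[symmetric] by (simp add: sum.reindex[OF inj])
    finally show ?thesis using v(2) im that by auto
  qed
  moreover have "\<exists>x\<in>V. v (f x) \<noteq> 0" using v(1) im by auto
  ultimately show "mu \<in> Q_eigenvalues V E"
    unfolding Q_eigenvalues_def by (intro CollectI exI[of _ "\<lambda>x. v (f x)"]) auto
qed

lemma graph_iso_q_radius:
  assumes "graph_iso V E V' E'"
  shows "q_radius V E = q_radius V' E'"
proof -
  obtain f where f: "bij_betw f V V'" "\<forall>x\<in>V. \<forall>y\<in>V. adj E x y \<longleftrightarrow> adj E' (f x) (f y)"
    using assms unfolding graph_iso_def by blast
  let ?g = "inv_into V f"
  have g: "bij_betw ?g V' V" using f(1) by (rule bij_betw_inv_into)
  have "\<forall>x\<in>V'. \<forall>y\<in>V'. adj E' x y \<longleftrightarrow> adj E (?g x) (?g y)"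
    using f bij_betw_inv_into_right[OF f(1)] bij_betwE[OF g] by metis
  from graph_iso_eigenvalues[OF g this] graph_iso_eigenvalues[OF f]
  show ?thesis by (simp add: q_radius_def subset_antisym)
qed

text \<open>In \<open>M_E\<close> both X_2 and Y_2 carry the final labels of their class, so the
  same numbering serves X with \<open>X2\<close> and Y with \<open>T\<close>.\<close>

lemma bij_betw_onto_interval:
  assumes "finite X" "card X = n" "A \<subseteq> X" "card A = k"
  shows "\<exists>h. bij_betw h X {..<n} \<and> (\<forall>x\<in>X. x \<in> A \<longleftrightarrow> n - k \<le> h x)"
proof -
  have fA: "finite A" using assms finite_subset by blast
  have kn: "k \<le> n" using assms card_mono by metis
  have "card (X - A) = card {..<n - k}" using assms fA by (simp add: card_Diff_subset)
  then obtain h1 where h1: "bij_betw h1 (X - A) {..<n - k}"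
    using finite_same_card_bij[of "X - A" "{..<n - k}"] assms(1) by auto
  have "card A = card {n - k..<n}" using assms kn by simp
  then obtain h2 where h2: "bij_betw h2 A {n - k..<n}"
    using finite_same_card_bij[of A "{n - k..<n}"] fA by auto
  let ?h = "\<lambda>x. if x \<in> X - A then h1 x else h2 x"
  have "bij_betw ?h ((X - A) \<union> A) ({..<n - k} \<union> {n - k..<n})"
    by (rule bij_betw_disjoint_Un[OF h1 h2]) auto
  moreover have "(X - A) \<union> A = X" "{..<n - k} \<union> {n - k..<n} = {..<n}"
    using assms(3) kn by auto
  moreover have "\<forall>x\<in>X. x \<in> A \<longleftrightarrow> n - k \<le> ?h x"
  proof
    fix x assume "x \<in> X"
    then show "x \<in> A \<longleftrightarrow> n - k \<le> ?h x"
      using bij_betwE[OF h1] bij_betwE[OF h2] by (cases "x \<in> A") (auto dest: bspec[of _ _ x])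
  qed
  ultimately show ?thesis by (intro exI[of _ ?h]) simp
qed

lemma join_edges_iso:
  assumes fin: "finite X" "finite Y" and disj: "X \<inter> Y = {}" and card: "card X = n" "card Y = n"
    and X2: "X2 \<subseteq> X" "card X2 = k" and T: "T \<subseteq> Y" "card T = t"
  shows "graph_iso (X \<union> Y) (join_edges X Y X2 T) (M_X n \<union> M_Y n) (M_E n n (n - k) t)"
proof -
  let ?E = "join_edges X Y X2 T" and ?M = "M_E n n (n - k) t"
  obtain hX where hX: "bij_betw hX X {..<n}" "\<And>x. x \<in> X \<Longrightarrow> x \<in> X2 \<longleftrightarrow> n - k \<le> hX x"
    using bij_betw_onto_interval[OF fin(1) card(1) X2] by blast
  obtain hY where hY: "bij_betw hY Y {..<n}" "\<And>y. y \<in> Y \<Longrightarrow> y \<in> T \<longleftrightarrow> n - t \<le> hY y"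
    using bij_betw_onto_interval[OF fin(2) card(2) T] by blast
  have hXn: "hX x < n" if "x \<in> X" for x using bij_betwE[OF hX(1)] that by auto
  have hYn: "hY y < n" if "y \<in> Y" for y using bij_betwE[OF hY(1)] that by auto
  define f where "f v = (if v \<in> X then (0 :: nat, hX v) else (1, hY v))" for v
  have fX: "f x = (0, hX x)" if "x \<in> X" for x using that by (simp add: f_def)
  have fY: "f y = (1, hY y)" if "y \<in> Y" for y using that disj by (auto simp: f_def)
  have b1: "bij_betw f X (M_X n)"
    unfolding bij_betw_def
  proof
    show "inj_on f X" using hX(1) fX by (auto simp: inj_on_def bij_betw_def)
    have "f ` X = Pair 0 ` hX ` X" using fX by force
    then show "f ` X = M_X n" using hX(1) by (auto simp: bij_betw_def M_X_def)
  qed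
  have b2: "bij_betw f Y (M_Y n)"
    unfolding bij_betw_def
  proof
    show "inj_on f Y" using hY(1) fY by (auto simp: inj_on_def bij_betw_def)
    have "f ` Y = Pair 1 ` hY ` Y" using fY by force
    then show "f ` Y = M_Y n" using hY(1) by (auto simp: bij_betw_def M_Y_def)
  qed
  have bij: "bij_betw f (X \<union> Y) (M_X n \<union> M_Y n)"
    by (rule bij_betw_combine[OF b1 b2]) (auto simp: M_X_def M_Y_def)
  have xy: "adj ?E x y \<longleftrightarrow> adj ?M (f x) (f y)" if "x \<in> X" "y \<in> Y" for x y
  proof -
    have "adj ?M (f x) (f y) \<longleftrightarrow> hY y < n - t \<or> n - k \<le> hX x"
      using hXn[OF that(1)] hYn[OF that(2)] unfolding fX[OF that(1)] fY[OF that(2)] adj_def M_E_def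
      by (auto simp: doubleton_eq_iff)
    then show ?thesis
      using join_edges_adj[OF disj that, of X2 T] hX(2)[OF that(1)] hY(2)[OF that(2)] by auto
  qed
  have xx: "\<not> adj ?M (f x) (f x')" if "x \<in> X" "x' \<in> X" for x x'
    using that by (auto simp: fX adj_def M_E_def doubleton_eq_iff)
  have yy: "\<not> adj ?M (f x) (f x')" if "x \<in> Y" "x' \<in> Y" for x x'
    using that by (auto simp: fY adj_def M_E_def doubleton_eq_iff)
  note no = bipartite_no_adj[OF join_edges_bipartite[OF fin disj, of X2 T]]
  have "\<forall>x\<in>X \<union> Y. \<forall>y\<in>X \<union> Y. adj ?E x y \<longleftrightarrow> adj ?M (f x) (f y)"
  proof (intro ballI)
    fix x y assume "x \<in> X \<union> Y" "y \<in> X \<union> Y"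
    then consider "x \<in> X" "y \<in> X" | "x \<in> Y" "y \<in> Y" | "x \<in> X" "y \<in> Y" | "y \<in> X" "x \<in> Y" by blast
    then show "adj ?E x y \<longleftrightarrow> adj ?M (f x) (f y)"
    proof cases
      case 1 then show ?thesis using no(1) xx by blast
    next
      case 2 then show ?thesis using no(2) yy by blast
    next
      case 3 then show ?thesis by (rule xy)
    next
      case 4
      then show ?thesis using xy[of y x] adj_sym[of ?E x y] adj_sym[of ?M "f x" "f y"] by blast
    qed
  qed
  with bij show ?thesis unfolding graph_iso_def by blast
qed

text \<open>The Rayleigh bound for vectors with value a on X, b on Y - T and z on T. One value for
  all of X is accurate enough for both later uses.\<close>

lemma join_edges_test_vector:
  fixes a b z :: real
  assumes fin: "finite X" "finite Y" and disj: "X \<inter> Y = {}" and card: "card X = n" "card Y = n"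
    and X2: "X2 \<subseteq> X" "card X2 = k" and T: "T \<subseteq> Y" "card T = t" and n: "n > 0"
  shows "real n * real (n - t) * (a + b)\<^sup>2 + real k * real t * (a + z)\<^sup>2 \<le>
    q_radius (X \<union> Y) (join_edges X Y X2 T) * (real n * a\<^sup>2 + real (n - t) * b\<^sup>2 + real t * z\<^sup>2)"
proof -
  let ?E = "join_edges X Y X2 T"
  define g where "g v = (if v \<in> X then a else if v \<in> T then z else b)" for v
  have fT: "finite T" using T fin finite_subset by blast
  have gX: "g x = a" if "x \<in> X" for x using that by (simp add: g_def)
  have gY: "g y = (if y \<in> T then z else b)" if "y \<in> Y" for y using that disj by (auto simp: g_def)
  have Ysplit: "(\<Sum>y\<in>Y. h y) = (\<Sum>y\<in>T. h y) + (\<Sum>y\<in>Y - T. h y)" for h :: "'a \<Rightarrow> real"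
    using sum.subset_diff[OF T(1) fin(2), of h] by simp
  have cYT: "card (Y - T) = n - t" using T card fT by (simp add: card_Diff_subset)
  have "(\<Sum>y\<in>T. \<Sum>x\<in>nbs ?E X y. (g x + g y)\<^sup>2) = (\<Sum>y\<in>T. \<Sum>x\<in>X2. (a + z)\<^sup>2)"
  proof (rule sum.cong[OF refl])
    fix y assume y: "y \<in> T"
    then have "nbs ?E X y = X2" using join_edges_nbs(2)[OF disj X2(1) T(1)] T by auto
    moreover have "g y = z" using gY[of y] y T by auto
    ultimately show "(\<Sum>x\<in>nbs ?E X y. (g x + g y)\<^sup>2) = (\<Sum>x\<in>X2. (a + z)\<^sup>2)"
      using gX X2(1) by (intro sum.cong) auto
  qed
  moreover have "(\<Sum>y\<in>Y - T. \<Sum>x\<in>nbs ?E X y. (g x + g y)\<^sup>2) = (\<Sum>y\<in>Y - T. \<Sum>x\<in>X. (a + b)\<^sup>2)"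
  proof (rule sum.cong[OF refl])
    fix y assume y: "y \<in> Y - T"
    then have "nbs ?E X y = X" using join_edges_nbs(2)[OF disj X2(1) T(1)] T by auto
    moreover have "g y = b" using gY[of y] y by auto
    ultimately show "(\<Sum>x\<in>nbs ?E X y. (g x + g y)\<^sup>2) = (\<Sum>x\<in>X. (a + b)\<^sup>2)"
      using gX by (intro sum.cong) auto
  qed
  ultimately have B: "bilin (X \<union> Y) (signless_laplacian (X \<union> Y) ?E) g g =
      real n * real (n - t) * (a + b)\<^sup>2 + real k * real t * (a + z)\<^sup>2"
    unfolding bipartite_form[OF join_edges_bipartite[OF fin disj]] Ysplit
    using cYT card X2 T by simp
  have I: "inprod (X \<union> Y) g g = real n * a\<^sup>2 + real (n - t) * b\<^sup>2 + real t * z\<^sup>2"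
  proof -
    have "(\<Sum>x\<in>X. g x * g x) = n * a\<^sup>2" using gX card by (simp add: power2_eq_square)
    moreover have "(\<Sum>y\<in>T. g y * g y) = (\<Sum>y\<in>T. z\<^sup>2)"
      using gY T by (intro sum.cong) (auto simp: power2_eq_square)
    moreover have "(\<Sum>y\<in>Y - T. g y * g y) = (\<Sum>y\<in>Y - T. b\<^sup>2)"
      using gY by (intro sum.cong) (auto simp: power2_eq_square)
    ultimately show ?thesis
      unfolding inprod_def sum.union_disjoint[OF fin disj] Ysplit using cYT T by simp
  qed
  have "X \<union> Y \<noteq> {}" using card n by auto
  from q_radius_maximal_vector(1)[OF _ this, of ?E g] show ?thesis
    using fin unfolding B I by simp
qed

section \<open>Shifting neighbourhoods along a Perron vector\<close>

lemma ex_top_subset: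
  fixes f :: "'a \<Rightarrow> real"
  assumes "finite X" "k \<le> card X"
  shows "\<exists>A\<subseteq>X. card A = k \<and> (\<forall>a\<in>A. \<forall>b\<in>X - A. f b \<le> f a)"
  using assms(2)
proof (induction k)
  case 0
  then show ?case by (intro exI[of _ "{}"]) auto
next
  case (Suc k)
  then obtain A where A: "A \<subseteq> X" "card A = k" "\<forall>a\<in>A. \<forall>b\<in>X - A. f b \<le> f a" by auto
  have fA: "finite A" using A assms finite_subset by blast
  have "card (X - A) > 0" using A Suc.prems fA by (simp add: card_Diff_subset)
  then have ne: "X - A \<noteq> {}" "finite (X - A)" by (auto simp: card_gt_0_iff)
  then have "Max (f ` (X - A)) \<in> f ` (X - A)" by (intro Max_in) auto
  then obtain z where z: "z \<in> X - A" "f z = Max (f ` (X - A))" by force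
  have "f b \<le> f z" if "b \<in> X - A" for b unfolding z(2) using ne that by simp
  then show ?case using A z fA by (intro exI[of _ "insert z A"]) auto
qed

text \<open>An exchange argument: N - A injects into A - N, and no exchange lowers the value.
  Nonnegativity handles the elements of A left over when N is smaller.\<close>

lemma sum_le_top_subset:
  fixes h :: "'a \<Rightarrow> real"
  assumes fin: "finite X" and A: "A \<subseteq> X" and N: "N \<subseteq> X" "card N \<le> card A"
    and top: "\<And>a b. a \<in> A \<Longrightarrow> b \<in> X - A \<Longrightarrow> h b \<le> h a" and pos: "\<And>x. x \<in> X \<Longrightarrow> 0 \<le> h x"
  shows "sum h N \<le> sum h A"
    and "(\<And>a b. a \<in> A \<Longrightarrow> b \<in> X - A \<Longrightarrow> h b < h a) \<Longrightarrow> (\<And>x. x \<in> X \<Longrightarrow> 0 < h x) \<Longrightarrow>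
      N \<noteq> A \<Longrightarrow> sum h N < sum h A"
proof -
  have f: "finite N" "finite A" using fin A N finite_subset by blast+
  have sN: "sum h N = sum h (N - A) + sum h (N \<inter> A)"
    using f sum.Int_Diff[of N h A] by simp
  have sA: "sum h A = sum h (A - N) + sum h (N \<inter> A)"
    using f sum.Int_Diff[of A h N] by (simp add: Int_commute)
  have "card (N - A) \<le> card (A - N)"
    using N(2) f by (simp add: card_Diff_subset_Int Int_commute diff_le_mono)
  then obtain j where j: "j ` (N - A) \<subseteq> A - N" "inj_on j (N - A)"
    using card_le_inj[of "N - A" "A - N"] f by blast
  have im: "(\<Sum>x\<in>N - A. h (j x)) = sum h (j ` (N - A))"
    using j(2) by (simp add: sum.reindex)
  have im_le: "sum h (j ` (N - A)) \<le> sum h (A - N)"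
    using f j A pos by (intro sum_mono2) auto
  have "sum h (N - A) \<le> (\<Sum>x\<in>N - A. h (j x))"
    using j N by (intro sum_mono top) auto
  then show "sum h N \<le> sum h A" using im im_le sN sA by linarith
  assume strict: "\<And>a b. a \<in> A \<Longrightarrow> b \<in> X - A \<Longrightarrow> h b < h a" "\<And>x. x \<in> X \<Longrightarrow> 0 < h x" "N \<noteq> A"
  show "sum h N < sum h A"
  proof (cases "N - A = {}")
    case True
    then have "sum h (A - N) > 0"
      using strict f A by (intro sum_pos) auto
    then show ?thesis using sN sA True by simp
  next
    case False
    have "sum h (N - A) < (\<Sum>x\<in>N - A. h (j x))"
      using j N f False by (intro sum_strict_mono strict(1)) auto
    then show ?thesis using im im_le sN sA by linarith
  qed
qed

text \<open>The extremal graph is recovered from a Perron vector of G: replacing the neighbourhoods of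
  the low vertices by the k largest entries can only increase the quadratic form.\<close>

lemma low_degree_extremal:
  assumes b: "bipartite_graph X Y E" and card: "card X = n" "card Y = n"
    and T: "T \<subseteq> Y" "card T = t" "\<And>y. y \<in> T \<Longrightarrow> card (nbs E X y) \<le> k"
    and kt: "1 \<le> k" "k \<le> n" "1 \<le> t" "t < n"
    and q: "\<And>X2. X2 \<subseteq> X \<Longrightarrow> card X2 = k \<Longrightarrow>
      q_radius (X \<union> Y) (join_edges X Y X2 T) \<le> q_radius (X \<union> Y) E"
  shows "\<exists>X2\<subseteq>X. card X2 = k \<and> E = join_edges X Y X2 T"
proof -
  let ?V = "X \<union> Y"
  have fin: "finite X" "finite Y" and disj: "X \<inter> Y = {}" using b by (auto simp: bipartite_graph_def)
  have V: "finite ?V" "?V \<noteq> {}" using fin card kt by auto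
  have fT: "finite T" using T fin finite_subset by blast
  obtain f where f: "\<And>x. f x \<ge> 0" "\<exists>x\<in>?V. f x \<noteq> 0"
    "bilin ?V (signless_laplacian ?V E) f f = q_radius ?V E * inprod ?V f f"
    using q_radius_maximal_vector(2)[OF V, of E] by blast
  \<comment> \<open>The set A depends on the vector f, which is why the hypothesis \<open>q\<close>
    ranges over all k-subsets of X.\<close>
  obtain A where A: "A \<subseteq> X" "card A = k" "\<And>a b. a \<in> A \<Longrightarrow> b \<in> X - A \<Longrightarrow> f b \<le> f a"
    using ex_top_subset[OF fin(1), of k f] card kt by auto
  let ?M = "join_edges X Y A T"
  define l where "l = q_radius ?V ?M"
  have bM: "bipartite_graph X Y ?M" by (rule join_edges_bipartite[OF fin disj])
  note nX = join_edges_nbs(1)[OF disj A(1) T(1)] and nY = join_edges_nbs(2)[OF disj A(1) T(1)]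
  define s where "s F y = (\<Sum>x\<in>nbs F X y. (f x + f y)\<^sup>2)" for F y
  have sub: "nbs E X y \<subseteq> X" for y by (auto simp: nbs_def)
  have mono: "(f x + f y)\<^sup>2 \<le> (f x' + f y)\<^sup>2" if "f x \<le> f x'" for x x' y
    using that f(1) by (intro power_mono) auto
  have s_le: "s E y \<le> s ?M y" if "y \<in> Y" for y
  proof (cases "y \<in> T")
    case True
    then have "nbs ?M X y = A" using nY that by simp
    moreover have "s E y \<le> (\<Sum>x\<in>A. (f x + f y)\<^sup>2)"
      unfolding s_def
      by (rule sum_le_top_subset(1)[OF fin(1) A(1) sub]) (use A T(3)[OF True] mono in auto)
    ultimately show ?thesis by (simp add: s_def)
  next
    case False
    then have "nbs ?M X y = X" using nY that by simp
    then show ?thesis unfolding s_def using fin sub by (auto intro!: sum_mono2)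
  qed
  have BE: "bilin ?V (signless_laplacian ?V E) f f = (\<Sum>y\<in>Y. s E y)"
    and BM: "bilin ?V (signless_laplacian ?V ?M) f f = (\<Sum>y\<in>Y. s ?M y)"
    unfolding bipartite_form[OF b] bipartite_form[OF bM] s_def by auto
  have I: "inprod ?V f f > 0" using f(2) inprod_pos[OF V(1)] by blast
  have bound: "bilin ?V (signless_laplacian ?V ?M) g g \<le> l * inprod ?V g g" for g
    unfolding l_def by (rule q_radius_maximal_vector(1)[OF V])
  \<comment> \<open>The forms are squeezed: l|f|^2 \<le> q(G)|f|^2 = form of G \<le> form of M \<le>
    l|f|^2. Hence f is also a maximal vector for M, and the contributions agree at every vertex of
    Y.\<close>
  have "l * inprod ?V f f \<le> q_radius ?V E * inprod ?V f f"
    using q[OF A(1,2)] I by (simp add: l_def)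
  also have "\<dots> = (\<Sum>y\<in>Y. s E y)" using f(3) BE by simp
  finally have le1: "l * inprod ?V f f \<le> (\<Sum>y\<in>Y. s E y)" .
  have le2: "(\<Sum>y\<in>Y. s E y) \<le> (\<Sum>y\<in>Y. s ?M y)" by (intro sum_mono s_le)
  have eq: "bilin ?V (signless_laplacian ?V ?M) f f = l * inprod ?V f f"
    using le1 le2 bound[of f] BM by linarith
  have s_eq: "s E y = s ?M y" if "y \<in> Y" for y
  proof (rule ccontr)
    assume "s E y \<noteq> s ?M y"
    then have "s E y < s ?M y" using s_le[OF that] by simp
    then have "(\<Sum>y\<in>Y. s E y) < (\<Sum>y\<in>Y. s ?M y)"
      using fin that s_le by (intro sum_strict_mono_ex1) auto
    then show False using le1 bound[of f] BM by linarith
  qed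
  have eig: "(\<Sum>y\<in>?V. signless_laplacian ?V ?M x y * f y) = l * f x" if "x \<in> ?V" for x
    by (rule maximal_vector_eigenvector[where A = "signless_laplacian ?V ?M", OF V(1) signless_laplacian_sym bound eq that])
  have rA: "n * f x + sum f Y = l * f x" if "x \<in> A" for x
    using eig[of x] bipartite_row[OF bM, of x f] nX[of x] that A(1) card by (auto simp: sum.distrib)
  have rX: "(n - t) * f x + sum f (Y - T) = l * f x" if "x \<in> X - A" for x
    using eig[of x] bipartite_row[OF bM, of x f] nX[of x] that card T fT
    by (auto simp: sum.distrib card_Diff_subset)
  have rT: "k * f y + sum f A = l * f y" if "y \<in> T" for y
    using eig[of y] bipartite_row'[OF bM, of y f] nY[of y] that A(2) T(1) by (auto simp: sum.distrib)
  have rY: "n * f y + sum f X = l * f y" if "y \<in> Y - T" for y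
    using eig[of y] bipartite_row'[OF bM, of y f] nY[of y] that card by (auto simp: sum.distrib)
  have sum0: "f x = 0" if "sum f S = 0" "finite S" "x \<in> S" for S x
    using that f(1) by (simp add: sum_nonneg_eq_0_iff)
  have neA: "A \<noteq> {}" using A kt by auto
  have neY: "Y - T \<noteq> {}" using T card kt by (metis Diff_eq_empty_iff card_mono fT leD)
  have fA: "finite A" using A fin finite_subset by blast
  \<comment> \<open>Positivity spreads in M because A is joined to all of Y and Y - T to all of X;
    both sets are nonempty as k \<ge> 1 and t < n.\<close>
  have Y_A: "f x > 0" if "x \<in> A" "\<exists>y\<in>Y. f y \<noteq> 0" for x
    using rA[OF that(1)] sum0[OF _ fin(2)] that(2) f(1)[of x] by (cases "f x = 0") auto
  have X_Y: "f y > 0" if "y \<in> Y - T" "\<exists>x\<in>X. f x \<noteq> 0" for y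
    using rY[OF that(1)] sum0[OF _ fin(1)] that(2) f(1)[of y] by (cases "f y = 0") auto
  have exX: "\<exists>x\<in>X. f x \<noteq> 0"
  proof (rule ccontr)
    assume "\<not> ?thesis"
    moreover from this have "\<exists>y\<in>Y. f y \<noteq> 0" using f(2) by auto
    ultimately show False using Y_A neA A(1) by fastforce
  qed
  have exY: "\<exists>y\<in>Y. f y \<noteq> 0" using X_Y[OF _ exX] neY by fastforce
  have pA: "f x > 0" if "x \<in> A" for x by (rule Y_A[OF that exY])
  have pY: "f y > 0" if "y \<in> Y - T" for y by (rule X_Y[OF that exX])
  have pX: "f x > 0" if "x \<in> X" for x
  proof (cases "x \<in> A")
    case False
    then have x: "x \<in> X - A" using that by simp
    show ?thesis
    proof (rule ccontr)
      assume "\<not> ?thesis"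
      then have "f x = 0" using f(1)[of x] by simp
      then have "sum f (Y - T) = 0" using rX[OF x] by simp
      then show False using sum0[of "Y - T"] neY pY fin by fastforce
    qed
  qed (rule pA)
  have pT: "f y > 0" if "y \<in> T" for y
  proof (rule ccontr)
    assume "\<not> ?thesis"
    then have "f y = 0" using f(1)[of y] by simp
    then have "sum f A = 0" using rT[OF that] by simp
    then show False using sum0[of A] neA pA fA by fastforce
  qed
  have sT: "sum f T > 0" using pT T kt fT by (intro sum_pos) auto
  have sY: "sum f Y = sum f (Y - T) + sum f T"
    using sum.subset_diff[OF T(1) fin(2), of f] by simp
  \<comment> \<open>Ties between A and X - A would leave the best k-set ambiguous. The rows of M
    exclude them: (l-n) f a sums f over Y, while (l-n+t) f b' sums only over Y - T, and f is
    positive on T.\<close>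
  have gap: "f b' < f a" if "a \<in> A" "b' \<in> X - A" for a b'
  proof -
    have 1: "(l - n) * f a = sum f Y" using rA[OF that(1)] by (simp add: algebra_simps)
    have "sum f Y > 0" using sT sY sum_nonneg[of "Y - T" f] f(1) by simp
    then have ln: "l - n > 0" using 1 pA[OF that(1)] by (metis zero_less_mult_pos2)
    have "(l - n) * f b' \<le> (l - (n - t)) * f b'"
      using f(1)[of b'] kt by (intro mult_right_mono) auto
    also have "\<dots> = sum f (Y - T)" using rX[OF that(2)] kt by (simp add: algebra_simps of_nat_diff)
    also have "\<dots> < (l - n) * f a" using 1 sY sT by simp
    finally show ?thesis using ln by simp
  qed
  have nbE: "nbs E X y = (if y \<in> T then A else X)" if y: "y \<in> Y" for y
  proof (rule ccontr)
    assume ne: "nbs E X y \<noteq> (if y \<in> T then A else X)"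
    have fy: "f y > 0" using y pT pY by blast
    have hpos: "0 < (f x + f y)\<^sup>2" if "x \<in> X" for x
      using pX[OF that] fy by (intro zero_less_power) auto
    have "s E y < s ?M y"
    proof (cases "y \<in> T")
      case True
      have "(\<Sum>x\<in>nbs E X y. (f x + f y)\<^sup>2) < (\<Sum>x\<in>A. (f x + f y)\<^sup>2)"
      proof (rule sum_le_top_subset(2)[OF fin(1) A(1) sub])
        show "card (nbs E X y) \<le> card A" using A T True by simp
        show "(f b' + f y)\<^sup>2 \<le> (f a + f y)\<^sup>2" if "a \<in> A" "b' \<in> X - A" for a b'
          by (rule mono[OF A(3)[OF that]])
        show "(f b' + f y)\<^sup>2 < (f a + f y)\<^sup>2" if "a \<in> A" "b' \<in> X - A" for a b'
          using gap[OF that] f(1) by (intro power_strict_mono) auto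
      qed (use hpos ne True in auto)
      then show ?thesis using True nY[OF y] by (simp add: s_def)
    next
      case False
      then have "nbs E X y \<subset> X" using ne sub by auto
      then obtain x' where x': "x' \<in> X - nbs E X y" by blast
      have "(\<Sum>x\<in>nbs E X y. (f x + f y)\<^sup>2) < (\<Sum>x\<in>X. (f x + f y)\<^sup>2)"
        by (rule sum_strict_mono2[OF fin(1) sub x']) (use hpos x' in auto)
      then show ?thesis using False nY[OF y] by (simp add: s_def)
    qed
    then show False using s_eq[OF y] by simp
  qed
  have "E = ?M"
  proof
    show "E \<subseteq> ?M"
    proof
      fix e assume "e \<in> E"
      then obtain x y where xy: "e = {x, y}" "x \<in> X" "y \<in> Y" by (rule bipartite_edgeD[OF b])
      then have "x \<in> nbs E X y" using \<open>e \<in> E\<close> by (simp add: nbs_def adj_def insert_commute)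
      then show "e \<in> ?M" using nbE[OF xy(3)] xy by (auto simp: join_edges_def split: if_splits)
    qed
    show "?M \<subseteq> E"
    proof
      fix e assume "e \<in> ?M"
      then obtain x y where xy: "e = {x, y}" "x \<in> X" "y \<in> Y" "x \<in> A \<or> y \<notin> T"
        unfolding join_edges_def by blast
      then have "x \<in> nbs E X y" using nbE[OF xy(3)] by auto
      then show "e \<in> E" using xy(1) by (simp add: nbs_def adj_def insert_commute)
    qed
  qed
  then show ?thesis using A by blast
qed

section \<open>Second-order comparison for two adjacent low vertices\<close>

text \<open>The slack in the row of a further neighbour of x0 or y0, for the weights used next: the
  row sum falls short by exactly this positive amount of second order in 1/d.\<close>

lemma cross_row_identity:
  fixes d k n :: real
  assumes "d > 0" "2 * n = d + k + 3"
  shows "(2 * n - 2 + 2 * (k - 1) / d) * ((d + 2) / d) -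
    (n * ((d + 2) / d) + (k - 1) * (d + 2) / d\<^sup>2 + (k - 1) * ((d + 2) / d) + (n - k)) = 2 * (k - 1) / d\<^sup>2"
proof -
  have n: "n = (d + k + 3) / 2" using assms(2) by simp
  show ?thesis unfolding n using assms(1) by (simp add: divide_simps power2_eq_square) (simp add: algebra_simps)
qed

text \<open>The weights are an approximate Perron vector of the graph in which every edge not incident
  with x0 and y0 is present.\<close>

lemma cross_row_bounds:
  fixes n k :: nat
  assumes n: "n \<ge> 3 * (k + 2)" and k: "k \<ge> 2"
  defines "d \<equiv> 2 * real n - k - 3"
  defines "c \<equiv> (d + 2) / d" and "z \<equiv> (real k - 1) * (d + 2) / d\<^sup>2"
    and "l \<equiv> 2 * real n - 2 + 2 * (real k - 1) / d"
  shows "d > 0" "c \<ge> 1" "z > 0"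
    "(real k + 1) * z + (real k - 1) * c \<le> l * z"
    "real n * c + z + (real k - 1) * c + (real n - k) \<le> l * c"
    "2 * real n - k - 1 + (real k - 1) * c \<le> l"
proof -
  \<comment> \<open>The low vertices have weight z, their other neighbours c, all remaining vertices
    1. The row of weight 1 holds with equality for l = 2n-k-1 + (k-1)c. The row of weight z would be
    exact for (l-k-1)z = (k-1)c; replacing l by its main part 2n-2 turns l-k-1 into d, hence z =
    (k-1)c/d. Finally c = 1 + 2/d approximates the solution of (l-n)(c-1) = 1+z, the difference of
    the rows of weights c and 1.\<close>
  have n': "real n \<ge> 3 * (real k + 2)" using of_nat_mono[OF n, where ?'a = real] by simp
  have k': "real k \<ge> 2" using k by simp
  show d: "d > 0" using n' k' by (simp add: d_def)
  then show "c \<ge> 1" by (simp add: c_def)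
  show z: "z > 0" unfolding z_def using d k' by simp
  have e: "2 * (real k - 1) / d \<ge> 0" using d k' by simp
  have zc: "z * d = (real k - 1) * c" unfolding z_def c_def using d by (simp add: power2_eq_square)
  have ld: "l = d + (real k + 1) + 2 * (real k - 1) / d" by (simp add: l_def d_def)
  have "(real k + 1) * z + (real k - 1) * c = (real k + 1 + d) * z" using zc by (simp add: algebra_simps)
  also have "\<dots> \<le> l * z" unfolding ld using e z by (intro mult_right_mono) auto
  finally show "(real k + 1) * z + (real k - 1) * c \<le> l * z" .
  have "c * d = d + 2" using d by (simp add: c_def)
  then have kc: "(real k - 1) * c = (real k - 1) + 2 * (real k - 1) / d"
    using d by (simp add: c_def field_simps)
  then show "2 * real n - k - 1 + (real k - 1) * c \<le> l" by (simp add: l_def)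
  have nd: "2 * real n = d + k + 3" by (simp add: d_def)
  have "l * c - (real n * c + z + (real k - 1) * c + (real n - k)) = 2 * (real k - 1) / d\<^sup>2"
    unfolding l_def c_def z_def by (rule cross_row_identity[OF d nd])
  moreover have "2 * (real k - 1) / d\<^sup>2 \<ge> 0" using k' by simp
  ultimately show "real n * c + z + (real k - 1) * c + (real n - k) \<le> l * c" by linarith
qed

text \<open>The weights fit the complete configuration, but they serve every graph with such a pair:
  deleting edges lowers row sums, and since c \<ge> 1 a degree below k does no harm. The auxiliary
  fact \<open>row\<close> is stated for either order of the classes.\<close>

lemma q_radius_le_adjacent_low:
  assumes b: "bipartite_graph X Y E" and card: "card X = n" "card Y = n"
    and n: "n \<ge> 3 * (k + 2)" and k: "k \<ge> 2"
    and xy: "x0 \<in> X" "y0 \<in> Y" "adj E x0 y0" "card (nbs E Y x0) \<le> k" "card (nbs E X y0) \<le> k"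
  shows "q_radius (X \<union> Y) E \<le> 2 * real n - 2 + 2 * (real k - 1) / (2 * real n - k - 3)"
proof -
  have fin: "finite X" "finite Y" and disj: "X \<inter> Y = {}" using b by (auto simp: bipartite_graph_def)
  define d where "d = 2 * real n - k - 3"
  define c where "c = (d + 2) / d"
  define z where "z = (real k - 1) * (d + 2) / d\<^sup>2"
  define l where "l = 2 * real n - 2 + 2 * (real k - 1) / d"
  note wt = cross_row_bounds[OF n k, folded d_def, folded c_def z_def l_def]
  define w where "w v = (if v = x0 \<or> v = y0 then z else if adj E v x0 \<or> adj E v y0 then c else 1)" for v
  have row: "(\<Sum>y\<in>nbs E Q x. w x + w y) \<le> l * w x"
    if PQ: "finite Q" "card Q = n" "p0 \<in> P" "q0 \<in> Q" "x \<in> P" "P \<inter> Q = {}"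
      and low: "card (nbs E Q p0) \<le> k" "q0 \<in> nbs E Q p0"
      and wP: "\<And>x. x \<in> P \<Longrightarrow> w x = (if x = p0 then z else if q0 \<in> nbs E Q x then c else 1)"
      and wQ: "\<And>y. y \<in> Q \<Longrightarrow> w y = (if y = q0 then z else if y \<in> nbs E Q p0 then c else 1)"
    for P Q p0 q0 x
  proof -
    define B where "B = nbs E Q p0 - {q0}"
    have sub: "nbs E Q x \<subseteq> Q" for x by (auto simp: nbs_def)
    have fB: "finite B" "B \<subseteq> Q - {q0}"
      using finite_subset[OF sub PQ(1)] sub by (auto simp: B_def)
    have cB: "card (nbs E Q p0) = card B + 1"
      unfolding B_def using card_Suc_Diff1[OF finite_subset[OF sub PQ(1)] low(2)] by simp
    have cB': "real (card B) \<le> real k - 1" using cB low(1) by simp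
    have wB: "sum w B = card B * c"
      using wQ fB by (simp add: B_def subset_eq)
    have cQB: "card (Q - {q0} - B) = n - 1 - card B"
      using PQ fB by (simp add: card_Diff_subset)
    have "card B \<le> card (Q - {q0})" using fB PQ by (intro card_mono) auto
    then have Bn: "card B \<le> n - 1" using PQ by simp
    have n1: "n \<ge> 1" using n by simp
    have "sum w (Q - {q0} - B) = real (n - 1 - card B)"
    proof -
      have "sum w (Q - {q0} - B) = (\<Sum>y\<in>Q - {q0} - B. 1)"
        using wQ by (intro sum.cong) (auto simp: B_def)
      then show ?thesis using cQB by simp
    qed
    then have "sum w (Q - {q0}) = card B * c + (real n - 1 - card B)"
      using sum.subset_diff[OF fB(2), of w] PQ(1) wB Bn n1 by (simp add: of_nat_diff)
    also have "\<dots> = real n - 1 + card B * (c - 1)" by (simp add: algebra_simps)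
    also have "\<dots> \<le> real n - 1 + (real k - 1) * (c - 1)"
      using cB' wt(2) by (intro add_left_mono mult_right_mono) auto
    finally have S: "sum w (Q - {q0}) \<le> (real k - 1) * c + (real n - k)" by (simp add: algebra_simps)
    have wpos: "w y \<ge> 0" if "y \<in> Q" for y using wQ[OF that] wt by auto
    consider "x = p0" | "x \<noteq> p0" "q0 \<in> nbs E Q x" | "x \<noteq> p0" "q0 \<notin> nbs E Q x" by blast
    then show ?thesis
    proof cases
      case 1
      have "(\<Sum>y\<in>nbs E Q x. w x + w y) = card (nbs E Q p0) * z + sum w (nbs E Q p0)"
        using 1 wP[OF PQ(3)] by (simp add: sum.distrib)
      also have "sum w (nbs E Q p0) = z + card B * c"
        using sum.remove[OF finite_subset[OF sub PQ(1)] low(2), of w] wQ[OF PQ(4)] wB by (simp add: B_def)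
      also have "card (nbs E Q p0) * z + (z + card B * c) \<le> real k * z + (z + (real k - 1) * c)"
        using low(1) cB' wt(2,3) by (intro add_mono mult_right_mono) auto
      also have "\<dots> \<le> l * z" using wt(4) by (simp add: algebra_simps)
      finally show ?thesis using 1 wP[OF PQ(3)] by simp
    next
      case 2
      then have wx: "w x = c" using wP[OF PQ(5)] by simp
      have "(\<Sum>y\<in>nbs E Q x. w x + w y) \<le> (\<Sum>y\<in>Q. c + w y)"
        unfolding wx using PQ sub wpos wt(2) by (intro sum_mono2) (auto intro: add_nonneg_nonneg)
      also have "\<dots> = n * c + z + sum w (Q - {q0})"
        using PQ sum.remove[OF PQ(1,4), of w] wQ[OF PQ(4)] by (simp add: sum.distrib)
      also have "\<dots> \<le> l * c" using S wt(5) by simp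
      finally show ?thesis using wx by simp
    next
      case 3
      then have wx: "w x = 1" using wP[OF PQ(5)] by simp
      have "nbs E Q x \<subseteq> Q - {q0}" using 3 sub by auto
      then have "(\<Sum>y\<in>nbs E Q x. w x + w y) \<le> (\<Sum>y\<in>Q - {q0}. 1 + w y)"
        unfolding wx using PQ wpos by (intro sum_mono2) (auto intro: add_nonneg_nonneg)
      also have "\<dots> = real n - 1 + sum w (Q - {q0})"
        using PQ n1 by (simp add: sum.distrib of_nat_diff)
      also have "\<dots> \<le> l" using S wt(6) by simp
      finally show ?thesis using wx by simp
    qed
  qed
  have y0: "y0 \<in> nbs E Y x0" "x0 \<in> nbs E X y0"
    using xy by (auto simp: nbs_def adj_sym)
  have wX: "w x = (if x = x0 then z else if y0 \<in> nbs E Y x then c else 1)"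
    "w x = (if x = x0 then z else if x \<in> nbs E X y0 then c else 1)" if "x \<in> X" for x
    using that bipartite_no_adj(1)[OF b that xy(1)] disj xy(2) adj_sym[of E x y0]
    by (auto simp: w_def nbs_def)
  have wY: "w y = (if y = y0 then z else if x0 \<in> nbs E X y then c else 1)"
    "w y = (if y = y0 then z else if y \<in> nbs E Y x0 then c else 1)" if "y \<in> Y" for y
    using that bipartite_no_adj(2)[OF b that xy(2)] disj xy(1) adj_sym[of E y x0]
    by (auto simp: w_def nbs_def)
  show ?thesis
    unfolding d_def[symmetric] l_def[symmetric]
  proof (rule q_radius_le[where w = w])
    show "finite (X \<union> Y)" "X \<union> Y \<noteq> {}" using fin xy by auto
    show "w x > 0" for x using wt(2,3) by (auto simp: w_def)
    show "(\<Sum>y\<in>X \<union> Y. signless_laplacian (X \<union> Y) E x y * w y) \<le> l * w x" if x: "x \<in> X \<union> Y" for x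
    proof (cases "x \<in> X")
      case True
      show ?thesis unfolding bipartite_row[OF b True]
        by (rule row[OF fin(2) card(2) xy(1,2) True disj xy(4) y0(1) wX(1) wY(2)])
    next
      case False
      then have "x \<in> Y" using x by simp
      have disj': "Y \<inter> X = {}" using disj by blast
      show ?thesis unfolding bipartite_row'[OF b \<open>x \<in> Y\<close>]
        by (rule row[OF fin(1) card(1) xy(2,1) \<open>x \<in> Y\<close> disj' xy(5) y0(2) wY(1) wX(2)])
    qed
  qed
qed

text \<open>After cancelling the common part 2n-2, the test vector gains a term of leading order 2k
  n^2 where the assumed upper bound allows only 2(k-1) n^2. The difference 2 n^2 dominates all mixed
  terms once n \<ge> 3(k+2).\<close>

lemma test_vector_gap:
  fixes n k q :: real
  assumes n: "n \<ge> 3 * (k + 2)" and k: "k \<ge> 2"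
    and test: "\<And>z. n * (n - 2) * (2 * n - 2)\<^sup>2 + k * 2 * (n - 2 + z)\<^sup>2 \<le>
      q * (n * (n - 2)\<^sup>2 + (n - 2) * n\<^sup>2 + 2 * z\<^sup>2)"
  shows "q > 2 * n - 2 + 2 * (k - 1) / (2 * n - k - 3)"
proof (rule ccontr)
  assume "\<not> ?thesis"
  then have q: "q \<le> 2 * n - 2 + 2 * (k - 1) / (2 * n - k - 3)" by simp
  define D where "D = 2 * n - 2 - k"
  define r where "r = k / D"
  \<comment> \<open>This z maximises k(n-2+z)^2 - (2n-2)z^2: the derivative vanishes where z(2n-2-k)
    = k(n-2). The maximum is k(n-2)^2(1+r).\<close>
  define z where "z = r * (n - 2)"
  define S where "S = n * (n - 2)\<^sup>2 + (n - 2) * n\<^sup>2 + 2 * z\<^sup>2"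
  have D: "D > 1" "D - 1 = 2 * n - k - 3" "D \<ge> 5 * k" using n k by (auto simp: D_def)
  have r: "r * D = k" "r > 0" "r \<le> 1 / 5" using D k by (auto simp: r_def field_simps)
  have zD: "z * D = k * (n - 2)" unfolding r(1)[symmetric] by (simp add: z_def)
  have S0: "S \<ge> 0" using n k by (simp add: S_def)
  have S_eq: "S = n * (n - 2) * (2 * n - 2) + 2 * z\<^sup>2"
    by (simp add: S_def power2_eq_square algebra_simps)
  define e where "e = 2 * (k - 1) / (D - 1)"
  have "q * S \<le> (2 * n - 2 + e) * S"
    using q S0 unfolding e_def D(2) by (intro mult_right_mono)
  then have "n * (n - 2) * (2 * n - 2)\<^sup>2 + k * 2 * (n - 2 + z)\<^sup>2 \<le> (2 * n - 2 + e) * S"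
    using test[of z] unfolding S_def[symmetric] by linarith
  then have "2 * (k * (n - 2 + z)\<^sup>2 - (2 * n - 2) * z\<^sup>2) \<le> e * S"
    unfolding S_eq by (simp add: power2_eq_square algebra_simps)
  also have "k * (n - 2 + z)\<^sup>2 - (2 * n - 2) * z\<^sup>2 = k * (n - 2)\<^sup>2 + 2 * z * (k * (n - 2)) - D * z * z"
    by (simp add: D_def power2_eq_square algebra_simps)
  also have "\<dots> = k * (n - 2)\<^sup>2 + z * (k * (n - 2))"
    unfolding zD[symmetric] by (simp add: algebra_simps)
  also have "\<dots> = (n - 2) * ((n - 2) * (k * (1 + r)))"
    by (simp add: z_def power2_eq_square algebra_simps)
  finally have "2 * ((n - 2) * ((n - 2) * (k * (1 + r)))) * (D - 1) \<le> e * S * (D - 1)"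
    using D(1) by (intro mult_right_mono) auto
  also have "e * S * (D - 1) = 2 * (k - 1) * S" using D(1) by (simp add: e_def)
  also have "S = (n - 2) * (2 * n * (n - 1) + 2 * r\<^sup>2 * (n - 2))"
    unfolding S_eq z_def by (simp add: power2_eq_square algebra_simps)
  finally have "2 * (n - 2) * ((n - 2) * (k * (1 + r)) * (D - 1)) \<le>
      2 * (n - 2) * ((k - 1) * (2 * n * (n - 1) + 2 * r\<^sup>2 * (n - 2)))"
    by (simp add: algebra_simps)
  then have "(n - 2) * (k * (1 + r)) * (D - 1) \<le> (k - 1) * (2 * n * (n - 1) + 2 * r\<^sup>2 * (n - 2))"
    using n k by (subst (asm) mult_le_cancel_left_pos) auto
  also have "(n - 2) * (k * (1 + r)) * (D - 1) = (n - 2) * k * (D - 1 + r * D - r)"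
    by (simp add: algebra_simps)
  also have "D - 1 + r * D - r = 2 * n - 3 - r" using r by (simp add: D_def)
  finally have main: "(n - 2) * k * (2 * n - 3 - r) \<le> (k - 1) * (2 * n * (n - 1) + 2 * r\<^sup>2 * (n - 2))" .
  have "r\<^sup>2 \<le> (1 / 5)\<^sup>2" using r by (intro power_mono) auto
  then have "2 * r\<^sup>2 * (n - 2) \<le> 2 * (1 / 25) * (n - 2)"
    using n k by (intro mult_right_mono) (auto simp: power2_eq_square)
  then have "(k - 1) * (2 * n * (n - 1) + 2 * r\<^sup>2 * (n - 2)) \<le> (k - 1) * (2 * n * (n - 1) + 2 / 25 * (n - 2))"
    using k by (intro mult_left_mono) auto
  moreover have "(n - 2) * k * (2 * n - 3 - 1 / 5) \<le> (n - 2) * k * (2 * n - 3 - r)"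
    using r n k by (intro mult_left_mono) auto
  ultimately have le: "(n - 2) * k * (2 * n - 3 - 1 / 5) \<le> (k - 1) * (2 * n * (n - 1) + 2 / 25 * (n - 2))"
    using main by linarith
  have eq1: "(n - 2) * k * (2 * n - 3 - 1 / 5) = 2 * (k * (n * n)) - 36 / 5 * (k * n) + 32 / 5 * k"
    by (simp add: field_simps)
  have eq2: "(k - 1) * (2 * n * (n - 1) + 2 / 25 * (n - 2)) =
      2 * (k * (n * n)) - 48 / 25 * (k * n) - 4 / 25 * k - 2 * (n * n) + 48 / 25 * n + 4 / 25"
    by (simp add: field_simps)
  have "2 * (n * n) + 32 / 5 * k + 4 / 25 * k \<le> 48 / 25 * n + 132 / 25 * (k * n) + 4 / 25"
    using le unfolding eq1 eq2 by linarith
  \<comment> \<open>The lower bound on n turns the surplus 2 n^2 into 6kn + 12n, more than the mixed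
    terms on the right.\<close>
  moreover have "n * (6 * k + 12) \<le> n * (2 * n)" using n k by (intro mult_left_mono) auto
  then have "6 * (k * n) + 12 * n \<le> 2 * (n * n)" by (simp add: algebra_simps)
  moreover have "k * n \<ge> 0" "n \<ge> 12" using n k by auto
  ultimately show False using k by linarith
qed

section \<open>Assembling the spectral and combinatorial bounds\<close>

theorem theorem1p6:
  fixes X Y :: "'a set" and E :: "'a set set" and n k p :: nat
  assumes "bipartite_graph X Y E"
    and "card X = n" and "card Y = n"
    and "\<forall>v\<in>X \<union> Y. degree (X \<union> Y) E v \<ge> k"
    and "n \<ge> (k + 2) * (k - p + 1)"
    and "k \<ge> p + 1"
    and "q_radius (X \<union> Y) E \<ge> q_radius (M_X n \<union> M_Y n) (M_E n n (n - k) (k - p))"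
  shows "ham_biconnected_2p p X Y E \<or>
         graph_iso (X \<union> Y) E (M_X n \<union> M_Y n) (M_E n n (n - k) (k - p))"
proof (rule ccontr)
  assume neg: "\<not> ?thesis"
  note b = assms(1) and card = assms(2,3)
  define t where "t = k - p"
  let ?qM = "q_radius (M_X n \<union> M_Y n) (M_E n n (n - k) t)"
  have not_iso: "\<not> graph_iso (X \<union> Y) E (M_X n \<union> M_Y n) (M_E n n (n - k) t)"
    and qGM: "?qM \<le> q_radius (X \<union> Y) E" using neg assms(7) by (auto simp: t_def)
  have fin: "finite X" "finite Y" and disj: "X \<inter> Y = {}" using b by (auto simp: bipartite_graph_def)
  have kt: "k = t + p" "t \<ge> 1" using assms(6) by (auto simp: t_def)
  have n_ge: "n \<ge> (k + 2) * (t + 1)" using assms(5) by (simp add: t_def)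
  have "k + 2 \<le> (k + 2) * (t + 1)" by simp
  then have n_k: "n \<ge> k + 2" using n_ge by (rule le_trans)
  have degX: "k \<le> card (nbs E Y x)" if "x \<in> X" for x
    using bspec[OF assms(4), of x] bipartite_degree[OF b that] that by simp
  have degY: "k \<le> card (nbs E X y)" if "y \<in> Y" for y
    using bspec[OF assms(4), of y] bipartite_degree[OF bipartite_swap[OF b] that] that
    by (simp add: Un_commute)
  have qM: "q_radius (X \<union> Y) (join_edges X Y X2 T) = ?qM"
    if "X2 \<subseteq> X" "card X2 = k" "T \<subseteq> Y" "card T = t" for X2 T
    by (rule graph_iso_q_radius[OF join_edges_iso[OF fin disj card that]])
  have qM': "q_radius (Y \<union> X) (join_edges Y X X2 T) = ?qM"
    if "X2 \<subseteq> Y" "card X2 = k" "T \<subseteq> X" "card T = t" for X2 T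
    using graph_iso_q_radius[OF join_edges_iso[OF fin(2,1) _ card(2,1) that]] disj by (simp add: Int_commute)
  obtain X2 where X2: "X2 \<subseteq> X" "card X2 = k"
    using obtain_subset_with_card_n[of k X] card n_k by auto
  obtain T0 where T0: "T0 \<subseteq> Y" "card T0 = t"
    using obtain_subset_with_card_n[of t Y] card n_k kt by auto
  have test: "real n * real (n - t) * (a + c)\<^sup>2 + real k * real t * (a + z)\<^sup>2 \<le>
      ?qM * (real n * a\<^sup>2 + real (n - t) * c\<^sup>2 + real t * z\<^sup>2)" for a c z
    using join_edges_test_vector[OF fin disj card X2 T0] qM[OF X2 T0] n_k by simp
  have nt: "real (n - t) = real n - real t" "real n - real t > 0" "real n > 0"
    using n_k kt by (auto simp: of_nat_diff)
  have qM_gt: "?qM > 2 * real n - t"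
  proof (rule ccontr)
    assume "\<not> ?thesis"
    then have le: "?qM \<le> 2 * real n - t" by simp
    \<comment> \<open>The vector with n-t on X and n on Y - T is the Perron vector of the complete
      bipartite graph on these classes, whose radius is 2n-t. Extended by 0 to T, it gains the
      positive term kt(n-t)^2 from the edges at T, which gives strictness.\<close>
    let ?a = "real n - real t"
    let ?S = "real n * ?a\<^sup>2 + ?a * (real n)\<^sup>2"
    have "real n * ?a * (?a + real n)\<^sup>2 + real k * real t * ?a\<^sup>2 \<le> ?qM * ?S"
      using test[of ?a "real n" 0] nt by simp
    also have "\<dots> \<le> (2 * real n - t) * ?S" using le nt by (intro mult_right_mono) auto
    also have "\<dots> = real n * ?a * (?a + real n)\<^sup>2" by (simp add: power2_eq_square algebra_simps)
    finally have "real k * real t * ?a\<^sup>2 \<le> 0" by simp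
    moreover have "real k * real t * ?a\<^sup>2 > 0" using kt nt by simp
    ultimately show False by simp
  qed
  define e where "e = card {(x, y). x \<in> X \<and> y \<in> Y \<and> adj E x y}"
  have "q_radius (X \<union> Y) E \<le> n + real e / n"
    unfolding e_def using degX degY kt n_k by (intro q_radius_le_edges[OF b card]) force+
  then have "real n - t < real e / n" using qM_gt qGM by linarith
  then have "(real n - t) * n < e" using nt by (simp add: pos_less_divide_eq)
  then have e_gt: "n * n < e + n * t"
    using nt by (simp add: algebra_simps) (metis of_nat_add of_nat_less_iff of_nat_mult)
  have "card {(x, y). x \<in> X \<and> y \<in> Y \<and> \<not> adj E x y} + e = n * n"
  proof -
    have "{(x, y). x \<in> X \<and> y \<in> Y \<and> \<not> adj E x y} = X \<times> Y - {(x, y). x \<in> X \<and> y \<in> Y \<and> adj E x y}" by auto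
    moreover have sub: "{(x, y). x \<in> X \<and> y \<in> Y \<and> adj E x y} \<subseteq> X \<times> Y" by auto
    moreover have "card {(x, y). x \<in> X \<and> y \<in> Y \<and> adj E x y} \<le> card (X \<times> Y)"
      using fin sub by (intro card_mono) auto
    ultimately show ?thesis
      using fin card by (simp add: e_def card_Diff_subset finite_subset card_cartesian_product)
  qed
  then have miss: "card {(x, y). x \<in> X \<and> y \<in> Y \<and> \<not> adj E x y} < n * t" using e_gt by linarith
  obtain W u v where W: "W \<subseteq> X \<union> Y" "card (W \<inter> X) = card (W \<inter> Y)" "card W = 2 * p"
    and uv: "u \<in> X - W" "v \<in> Y - W" and no: "\<nexists>ps. ham_path E ((X - W) \<union> (Y - W)) u v ps"
    using neg unfolding ham_biconnected_2p_def ham_biconnected_def by blast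
  have "W = (W \<inter> X) \<union> (W \<inter> Y)" using W by blast
  moreover have "card ((W \<inter> X) \<union> (W \<inter> Y)) = card (W \<inter> X) + card (W \<inter> Y)"
    using fin disj by (intro card_Un_disjoint) auto
  ultimately have cW: "card (W \<inter> X) = p" "card (W \<inter> Y) = p" using W by auto
  define m where "m = n - p"
  have cX: "card (X - W) = m" "card (Y - W) = m"
    using card cW fin by (auto simp: m_def card_Diff_subset_Int Int_commute)
  \<comment> \<open>Used in both directions: minimum degree k in G leaves at least t = k-p after
    deletion, and degree at most t after deletion means degree at most k in G.\<close>
  have split: "card (nbs E S x) \<le> card (nbs E (S - W) x) + p" if "finite S" "card (W \<inter> S) = p" for S x
  proof -
    have "nbs E S x \<subseteq> nbs E (S - W) x \<union> (W \<inter> S)" by (auto simp: nbs_def)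
    then have "card (nbs E S x) \<le> card (nbs E (S - W) x \<union> (W \<inter> S))"
      using that by (intro card_mono) (auto simp: nbs_def)
    also have "\<dots> \<le> card (nbs E (S - W) x) + p" using card_Un_le that(2) by metis
    finally show ?thesis .
  qed
  have "m > 0" "m - t - 2 = n - k - 2" using n_k kt by (auto simp: m_def)
  have "card {(x, y). x \<in> X - W \<and> y \<in> Y - W \<and> \<not> adj E x y} < (t + 1) * (m - t - 2)"
  proof -
    have "card {(x, y). x \<in> X - W \<and> y \<in> Y - W \<and> \<not> adj E x y} \<le>
        card {(x, y). x \<in> X \<and> y \<in> Y \<and> \<not> adj E x y}"
      by (rule card_mono, rule finite_subset[of _ "X \<times> Y"]) (use fin in auto)
    also have "\<dots> < n * t" by (rule miss)
    also have "\<dots> \<le> (t + 1) * (n - k - 2)"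
    proof -
      obtain j where "n = (k + 2) + j" using n_k le_Suc_ex by blast
      then show ?thesis using n_ge by (simp add: algebra_simps)
    qed
    finally show ?thesis using \<open>m - t - 2 = n - k - 2\<close> by simp
  qed
  moreover have "t \<le> card (nbs E (Y - W) x)" if "x \<in> X - W" for x
    using degX[of x] split[OF fin(2) cW(2), of x] that kt by auto
  moreover have "t \<le> card (nbs E (X - W) y)" if "y \<in> Y - W" for y
    using degY[of y] split[OF fin(1) cW(1), of y] that kt by auto
  moreover have "\<nexists>c. alt_path (X - W) (Y - W) E u v m c"
    using ham_path_of_alt_path[OF _ _ _ cX \<open>m > 0\<close>] fin disj no by blast
  ultimately have low: "(\<exists>T\<subseteq>X - W. card T = t \<and> (\<forall>x\<in>T. card (nbs E (Y - W) x) \<le> t)) \<or>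
    (\<exists>T\<subseteq>Y - W. card T = t \<and> (\<forall>y\<in>T. card (nbs E (X - W) y) \<le> t)) \<or>
    (t = 2 \<and> (\<exists>x\<in>X - W. \<exists>y\<in>Y - W. adj E x y \<and> card (nbs E (Y - W) x) \<le> 2 \<and> card (nbs E (X - W) y) \<le> 2))"
    using fin disj cX uv kt(2) by (intro low_structure_no_path[of "X - W" "Y - W" m u v t E]) auto
  consider
      (1) T where "T \<subseteq> X - W" "card T = t" "\<forall>x\<in>T. card (nbs E (Y - W) x) \<le> t"
    | (2) T where "T \<subseteq> Y - W" "card T = t" "\<forall>y\<in>T. card (nbs E (X - W) y) \<le> t"
    | (3) x y where "t = 2" "x \<in> X - W" "y \<in> Y - W" "adj E x y" "card (nbs E (Y - W) x) \<le> 2"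
        "card (nbs E (X - W) y) \<le> 2"
    using low by (elim disjE exE conjE bexE) assumption+
  then show False
  proof cases
    case 1
    have "\<exists>X2\<subseteq>Y. card X2 = k \<and> E = join_edges Y X X2 T"
    proof (rule low_degree_extremal[OF bipartite_swap[OF b] card(2,1) _ 1(2)])
      show T: "T \<subseteq> X" using 1 by blast
      show "card (nbs E Y x) \<le> k" if "x \<in> T" for x
        using split[OF fin(2) cW(2), of x] bspec[OF 1(3) that] kt by simp
      show "q_radius (Y \<union> X) (join_edges Y X X2 T) \<le> q_radius (Y \<union> X) E"
        if "X2 \<subseteq> Y" "card X2 = k" for X2
        using qM'[OF that T 1(2)] qGM by (simp add: Un_commute)
    qed (use kt n_k in auto)
    then obtain X2 where "X2 \<subseteq> Y" "card X2 = k" "E = join_edges Y X X2 T" by blast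
    then show False
      using join_edges_iso[OF fin(2,1) _ card(2,1), of X2 k T t] 1 disj not_iso by (auto simp: Un_commute Int_commute)
  next
    case 2
    have "\<exists>X2\<subseteq>X. card X2 = k \<and> E = join_edges X Y X2 T"
    proof (rule low_degree_extremal[OF b card _ 2(2)])
      show T: "T \<subseteq> Y" using 2 by blast
      show "card (nbs E X y) \<le> k" if "y \<in> T" for y
        using split[OF fin(1) cW(1), of y] bspec[OF 2(3) that] kt by simp
      show "q_radius (X \<union> Y) (join_edges X Y X2 T) \<le> q_radius (X \<union> Y) E"
        if "X2 \<subseteq> X" "card X2 = k" for X2
        using qM[OF that T 2(2)] qGM by simp
    qed (use kt n_k in auto)
    then obtain X2 where "X2 \<subseteq> X" "card X2 = k" "E = join_edges X Y X2 T" by blast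
    then show False
      using join_edges_iso[OF fin disj card, of X2 k T t] 2 not_iso by auto
  next
    case 3
    have k2: "k \<ge> 2" and n3: "n \<ge> 3 * (k + 2)" using kt 3 n_ge by auto
    have xy: "x \<in> X" "y \<in> Y" using 3 by auto
    have low: "card (nbs E Y x) \<le> k" "card (nbs E X y) \<le> k"
      using split[OF fin(2) cW(2), of x] split[OF fin(1) cW(1), of y] 3 kt by auto
    have "?qM > 2 * real n - 2 + 2 * (real k - 1) / (2 * real n - k - 3)"
    proof (rule test_vector_gap)
      show "real n \<ge> 3 * (real k + 2)" using of_nat_mono[OF n3, where ?'a = real] by simp
      show "real k \<ge> 2" using k2 by simp
      have "2 * real n - 2 = real n - 2 + real n" by simp
      then show "real n * (real n - 2) * (2 * real n - 2)\<^sup>2 + real k * 2 * (real n - 2 + z)\<^sup>2 \<le>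
          ?qM * (real n * (real n - 2)\<^sup>2 + (real n - 2) * (real n)\<^sup>2 + 2 * z\<^sup>2)" for z
        using test[of "real n - 2" "real n" z] nt 3(1) by simp
    qed
    moreover have "q_radius (X \<union> Y) E \<le> 2 * real n - 2 + 2 * (real k - 1) / (2 * real n - k - 3)"
      by (rule q_radius_le_adjacent_low[OF b card n3 k2 xy 3(4) low])
    ultimately show False using qGM by linarith
  qed
qed

end
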